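(* Let $N\ge1$, $n\ge1$, $\kappa\ge0$. For $\lambda\in\widetilde{\mathcal{P}}_n^{(N)}$ let $k(\lambda)=\lambda_1+\left\lfloor\frac{n+1}2\right\rfloor$. Then \[ h_\lambda(1^N)=\frac{2^{-n}}{\left(\kappa+\frac12\right)_{k(\lambda)-1}\prod_{i=2}^N\left(\kappa+\frac12\right)_{\lambda_i}}\sum_{\lambda\preceq\mu,\ \mu_1\ge k(\lambda)}\frac{B(\lambda,\mu)}{\mu!}\sum_{j=k(\lambda)}^{\mu_1}\frac{\prod_{i=2}^N(1-j+\mu_i)_{\lambda_i-\mu_i}}{(j-k(\lambda))!\,(\mu_1-j)!}\,\frac{(-1)^{j-k(\lambda)}}{\kappa-\frac12+j}, \] where the outer sum is over $\mu\in\mathcal{P}_n^{(N)}$ with $\lambda\preceq\mu$ and $\mu_1\ge k(\lambda)$.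
   Context: A partition is a finite sequence $\lambda=(\lambda_1,\lambda_2,\ldots)$ of nonnegative integers with $\lambda_1\ge\lambda_2\ge\cdots\ge0$; partitions with the same nonzero components are identified (so $\lambda_i=0$ beyond the length). $|\lambda|=\sum_i\lambda_i$, $l(\lambda)$ is the number of nonzero components, $\mathcal{P}_n^{(N)}$ is the set of partitions with $|\lambda|=n$, $l(\lambda)\le N$, regarded as elements of $\mathbb{N}_0^N$, and $\widetilde{\mathcal{P}}_n^{(N)}=\{\lambda\in\mathcal{P}_n^{(N)}:\lambda_1=\lambda_2\}$. For $\alpha\in\mathbb{N}_0^N$: $x^\alpha=\prod_i x_i^{\alpha_i}$, $\alpha!=\prod_i\alpha_i!$, $(t)_\alpha=\prod_i(t)_{\alpha_i}$ with $(t)_k=\prod_{i=1}^k(t+i-1)$, and $\alpha^+$ is $\alpha$ sorted in nonincreasing order. $m_\lambda=\sum\{x^\alpha:\alpha^+=\lambda\}$, $e_1=\sum_{i=1}^N x_i$, $\widetilde m_\lambda=e_1^{\lambda_1-\lambda_2}m_{(\lambda_2,\lambda_2,\lambda_3,\ldots)}$. The set $\{\widetilde m_\lambda:\lambda\in\mathcal{P}_n^{(N)}\}$ is a basis of the homogeneous symmetric polynomials of degree $n$, and $B(\mu,\lambda)$ is defined by $m_\lambda=\sum_{\mu\in\mathcal{P}_n^{(N)}}B(\mu,\lambda)\widetilde m_\mu$. The relation $\mu\preceq\lambda$ means $|\mu|=|\lambda|$ and $\lambda_i\le\mu_i$ for all $i\ge2$. $1^N=(1,\ldots,1)\in\mathbb{R}^N$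 and $x^2=(x_1^2,\ldots,x_N^2)$. For $\mu\in\mathcal{P}_n^{(N)}$, \[h_\mu(x)=2^{-n}\sum_{\lambda\in\mathcal{P}_n^{(N)},\ \mu\preceq\lambda}\frac{B(\mu,\lambda)}{\lambda!\,(\kappa+\frac12)_\lambda}\,\frac{m_\lambda(x^2)}{m_\lambda(1^N)}.\] *)

theory Defs
  imports Complex_Main
begin

text \<open>
  Elements of \<open>\<nat>\<^sub>0\<^sup>N\<close> are functions \<open>nat \<Rightarrow> nat\<close> that are zero outside \<open>{1..N}\<close>, so components
  are numbered from 1 and a component beyond the length is 0. Polynomials in \<open>N\<close> variables are
  represented by the functions they induce on points \<open>x :: nat \<Rightarrow> real\<close>, of which only the
  components \<open>x 1, \<dots>, x N\<close> are read.
\<close>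

definition multiindices :: "nat \<Rightarrow> (nat \<Rightarrow> nat) set" where
  "multiindices N = {\<alpha>. \<forall>i. i \<notin> {1..N} \<longrightarrow> \<alpha> i = 0}"

definition weight :: "nat \<Rightarrow> (nat \<Rightarrow> nat) \<Rightarrow> nat" where
  "weight N \<alpha> = (\<Sum>i=1..N. \<alpha> i)"

definition Par :: "nat \<Rightarrow> nat \<Rightarrow> (nat \<Rightarrow> nat) set" where
  "Par N n = {\<rho> \<in> multiindices N.
      (\<forall>i\<in>{1..N}. \<forall>j\<in>{1..N}. i \<le> j \<longrightarrow> \<rho> j \<le> \<rho> i) \<and> weight N \<rho> = n}"

definition Par_tilde :: "nat \<Rightarrow> nat \<Rightarrow> (nat \<Rightarrow> nat) set" where
  "Par_tilde N n = {\<rho> \<in> Par N n. \<rho> 1 = \<rho> 2}"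

definition prec_eq :: "nat \<Rightarrow> (nat \<Rightarrow> nat) \<Rightarrow> (nat \<Rightarrow> nat) \<Rightarrow> bool" where
  "prec_eq N \<mu> \<rho> \<longleftrightarrow> weight N \<mu> = weight N \<rho> \<and> (\<forall>i\<ge>2. \<rho> i \<le> \<mu> i)"

definition multi_fact :: "nat \<Rightarrow> (nat \<Rightarrow> nat) \<Rightarrow> real" where
  "multi_fact N \<alpha> = (\<Prod>i=1..N. fact (\<alpha> i))"

definition multi_poch :: "nat \<Rightarrow> real \<Rightarrow> (nat \<Rightarrow> nat) \<Rightarrow> real" where
  "multi_poch N t \<alpha> = (\<Prod>i=1..N. pochhammer t (\<alpha> i))"

definition monomial :: "nat \<Rightarrow> (nat \<Rightarrow> nat) \<Rightarrow> (nat \<Rightarrow> real) \<Rightarrow> real" where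
  "monomial N \<alpha> x = (\<Prod>i=1..N. x i ^ \<alpha> i)"

definition rearrange :: "nat \<Rightarrow> (nat \<Rightarrow> nat) \<Rightarrow> (nat \<Rightarrow> nat)" where
  "rearrange N \<alpha> = (\<lambda>i. if i \<in> {1..N} then rev (sort (map \<alpha> [1..<Suc N])) ! (i - 1) else 0)"

definition msym :: "nat \<Rightarrow> (nat \<Rightarrow> nat) \<Rightarrow> (nat \<Rightarrow> real) \<Rightarrow> real" where
  "msym N \<rho> x = (\<Sum>\<alpha> | \<alpha> \<in> multiindices N \<and> rearrange N \<alpha> = \<rho>. monomial N \<alpha> x)"

definition e1 :: "nat \<Rightarrow> (nat \<Rightarrow> real) \<Rightarrow> real" where
  "e1 N x = (\<Sum>i=1..N. x i)"

definition msym_tilde :: "nat \<Rightarrow> (nat \<Rightarrow> nat) \<Rightarrow> (nat \<Rightarrow> real) \<Rightarrow> real" where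
  "msym_tilde N \<rho> x = e1 N x ^ (\<rho> 1 - \<rho> 2) * msym N (\<rho>(1 := \<rho> 2)) x"

text \<open>
  \<open>B N \<mu> \<rho>\<close> is the coefficient at \<open>\<mu>\<close> in the expansion of \<open>msym N \<rho>\<close> in the basis formed by
  the \<open>msym_tilde N \<nu>\<close>; the coefficients are extended by 0 outside the index set of the basis,
  which makes the coefficient function unique.
\<close>

definition B :: "nat \<Rightarrow> (nat \<Rightarrow> nat) \<Rightarrow> (nat \<Rightarrow> nat) \<Rightarrow> real" where
  "B N \<mu> \<rho> = (THE b :: (nat \<Rightarrow> nat) \<Rightarrow> real.
      (\<forall>\<nu>. \<nu> \<notin> Par N (weight N \<rho>) \<longrightarrow> b \<nu> = 0) \<and>
      (\<forall>x. msym N \<rho> x = (\<Sum>\<nu>\<in>Par N (weight N \<rho>). b \<nu> * msym_tilde N \<nu> x))) \<mu>"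

definition h :: "real \<Rightarrow> nat \<Rightarrow> (nat \<Rightarrow> nat) \<Rightarrow> (nat \<Rightarrow> real) \<Rightarrow> real" where
  "h \<kappa> N \<mu> x = 1 / 2 ^ weight N \<mu> *
     (\<Sum>\<rho> | \<rho> \<in> Par N (weight N \<mu>) \<and> prec_eq N \<mu> \<rho>.
        B N \<mu> \<rho> / (multi_fact N \<rho> * multi_poch N (\<kappa> + 1/2) \<rho>) *
        (msym N \<rho> (\<lambda>i. (x i)\<^sup>2) / msym N \<rho> (\<lambda>_. 1)))"

end

(*
  Put t = \<kappa> + 1/2. The numbers 2^n h_\<mu>(1^N) are the coefficients, in the basis of the
  msym_tilde, of the degree n part G_n(t, y) of \<Prod>_i 0F1(t; y_i). Taking logarithmic derivatives,
    n G_n = \<Sum>_{m\<ge>1} g_{m-1}(t) p_m G_{n-m},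
  where p_m is the m-th power sum and g = (log 0F1)' satisfies a Riccati equation, which gives
  g_m(t) = O(t^{-(2m+1)}). Multiplication by p_m preserves the multiples of e_1 = p_1, and these have
  no component along msym_tilde \<lambda> when \<lambda>_1 = \<lambda>_2; so only products of p_m with m \<ge> 2
  contribute and h_\<lambda>(1^N) = O(t^{-(n + ceiling(n/2))}). After multiplication by
  (t)_{k-1} \<Prod>_{i\<ge>2} (t)_{\<lambda>_i}, of degree n + ceiling(n/2) - 1, the result tends to 0 as
  t \<rightarrow> \<infinity>. In its partial fraction expansion the polynomial part therefore vanishes, and
  the remaining simple fractions are the asserted sum.
*)
theory Submission
  imports Defs "HOL-Combinatorics.Permutations" "HOL-Computational_Algebra.Polynomial"
    "HOL-Computational_Algebra.Formal_Power_Series" "HOL-Real_Asymp.Real_Asymp"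
begin

subsection \<open>Monomials and symmetric coefficient families\<close>

text \<open>For each single \<mu>, the quotient of (t)_{k-1} \<Prod>_{i\<ge>2} (t)_{\<lambda>_i} by
  (t)_\<mu> has degree ceiling(n/2) - 1 \<ge> 0 in t, hence a nonzero polynomial part. These parts
  cancel only after weighting with B(\<lambda>, \<mu>) / \<mu>!, and B is known only through
  existence, uniqueness and triangularity of the expansion. So the cancellation is read off from
  growth in t, which stays a free variable until it is set to \<kappa> + 1/2 at the very end.

  The exponent comes from a cost count: a factor p_m brings 2m - 1 powers of 1/t for m degrees.
  Without p_1, a product of r power sums of total degree n costs 2n - r powers, and r \<le> n/2
  yields at least n + ceiling(n/2); p_2 is the cheapest factor per degree. The index k(\<lambda>) is
  the largest one for which this bound still makes the product with the Pochhammer factors tend to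
  0.\<close>

definition hom_indices :: "nat \<Rightarrow> nat \<Rightarrow> (nat \<Rightarrow> nat) set" where
  "hom_indices N n = {\<alpha> \<in> multiindices N. weight N \<alpha> = n}"

lemma hom_indicesD:
  assumes "\<alpha> \<in> hom_indices N n"
  shows "\<alpha> \<in> multiindices N" "weight N \<alpha> = n"
  using assms by (auto simp: hom_indices_def)

lemma Par_subset_hom_indices: "Par N n \<subseteq> hom_indices N n"
  by (auto simp: Par_def hom_indices_def)

lemma finite_hom_indices: "finite (hom_indices N n)"
proof (rule finite_subset)
  show "finite {f. \<forall>x. (x \<in> {1..N} \<longrightarrow> f x \<in> {..n}) \<and> (x \<notin> {1..N} \<longrightarrow> f x = (0::nat))}"
    by (rule finite_set_of_finite_funs) auto
  show "hom_indices N n \<subseteq> {f. \<forall>x. (x \<in> {1..N} \<longrightarrow> f x \<in> {..n}) \<and> (x \<notin> {1..N} \<longrightarrow> f x = (0::nat))}"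
  proof
    fix \<alpha> assume a: "\<alpha> \<in> hom_indices N n"
    have "\<alpha> i \<le> n" if "i \<in> {1..N}" for i
    proof -
      have "\<alpha> i \<le> (\<Sum>i=1..N. \<alpha> i)"
        using that by (intro member_le_sum) auto
      then show ?thesis using a by (simp add: hom_indices_def weight_def)
    qed
    then show "\<alpha> \<in> {f. \<forall>x. (x \<in> {1..N} \<longrightarrow> f x \<in> {..n}) \<and> (x \<notin> {1..N} \<longrightarrow> f x = (0::nat))}"
      using a by (auto simp: hom_indices_def multiindices_def)
  qed
qed

lemma finite_Par: "finite (Par N n)"
  by (rule finite_subset[OF Par_subset_hom_indices finite_hom_indices])

lemma mset_map_upt: "mset (map f [1..<Suc N]) = image_mset f (mset_set {1..N})"
  by (simp only: mset_map mset_upt atLeastLessThanSuc_atLeastAtMost)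

lemma map_rearrange: "map (rearrange N \<alpha>) [1..<Suc N] = rev (sort (map \<alpha> [1..<Suc N]))"
  by (rule nth_equalityI) (auto simp: rearrange_def simp del: upt_Suc)

lemma rearrange_multiindices: "rearrange N \<alpha> \<in> multiindices N"
  by (auto simp: rearrange_def multiindices_def)

text \<open>Sorting keeps the multiset of values, and two families on \<open>{1..N}\<close> with the
  same multiset of values differ by a permutation. Off \<open>{1..N}\<close> both vanish.\<close>

lemma ex_rearrange_permutes:
  assumes "\<alpha> \<in> multiindices N"
  obtains \<pi> where "\<pi> permutes {1..N}" "rearrange N \<alpha> = \<alpha> \<circ> \<pi>"
proof -
  have "image_mset (rearrange N \<alpha>) (mset_set {1..N}) = image_mset \<alpha> (mset_set {1..N})"
    by (metis mset_map_upt map_rearrange mset_rev mset_sort)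
  then obtain p where p: "p permutes {1..N}" "\<forall>x\<in>{1..N}. rearrange N \<alpha> x = \<alpha> (p x)"
    using image_mset_eq_implies_permutes[of "{1..N}"] by blast
  have "rearrange N \<alpha> x = (\<alpha> \<circ> p) x" for x
    using p assms rearrange_multiindices[of N \<alpha>]
    by (cases "x \<in> {1..N}") (auto simp: multiindices_def permutes_def)
  then show thesis using that p(1) by blast
qed

lemma rearrange_permutes:
  assumes "\<pi> permutes {1..N}"
  shows "rearrange N (\<alpha> \<circ> \<pi>) = rearrange N \<alpha>"
proof -
  have "image_mset (\<alpha> \<circ> \<pi>) (mset_set {1..N}) = image_mset \<alpha> (mset_set {1..N})"
    using permutes_image_mset[OF assms] by (simp add: image_mset.compositionality[symmetric] permutes_image_mset[OF assms] flip: multiset.map_comp)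
  then have "mset (map (\<alpha> \<circ> \<pi>) [1..<Suc N]) = mset (map \<alpha> [1..<Suc N])"
    by (simp only: mset_map_upt)
  then have "sort (map (\<alpha> \<circ> \<pi>) [1..<Suc N]) = sort (map \<alpha> [1..<Suc N])"
    by (metis sorted_list_of_multiset_mset)
  then show ?thesis unfolding rearrange_def by (simp only:)
qed

lemma weight_permutes:
  assumes "\<pi> permutes {1..N}"
  shows "weight N (\<alpha> \<circ> \<pi>) = weight N \<alpha>"
  unfolding weight_def using sum.permute[OF assms, of \<alpha>] by simp

lemma weight_rearrange:
  assumes "\<alpha> \<in> multiindices N"
  shows "weight N (rearrange N \<alpha>) = weight N \<alpha>"
  using ex_rearrange_permutes[OF assms] weight_permutes by metis

lemma rearrange_antimono:
  assumes "i \<in> {1..N}" "j \<in> {1..N}" "i \<le> j"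
  shows "rearrange N \<alpha> j \<le> rearrange N \<alpha> i"
  using assms by (auto simp: rearrange_def simp del: upt_Suc intro!: sorted_rev_nth_mono)

lemma rearrange_in_Par:
  assumes "\<alpha> \<in> hom_indices N n"
  shows "rearrange N \<alpha> \<in> Par N n"
  using assms rearrange_antimono
  by (simp add: Par_def hom_indices_def weight_rearrange rearrange_multiindices)

lemma rearrange_Par:
  assumes "\<rho> \<in> Par N n"
  shows "rearrange N \<rho> = \<rho>"
proof -
  let ?xs = "map \<rho> [1..<Suc N]"
  have "sorted (rev ?xs)"
    unfolding sorted_wrt_rev
    using assms by (auto simp: Par_def sorted_wrt_iff_nth_less simp del: upt_Suc)
  then have "rev (sort ?xs) = ?xs"
    by (metis mset_rev rev_rev_ident sorted_list_of_multiset_mset sorted_sort_id)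
  then have "map (rearrange N \<rho>) [1..<Suc N] = map \<rho> [1..<Suc N]"
    by (simp only: map_rearrange)
  then have "\<forall>i\<in>{1..N}. rearrange N \<rho> i = \<rho> i"
    unfolding map_eq_conv by (simp add: atLeastLessThanSuc_atLeastAtMost del: upt_Suc)
  then show ?thesis
    using assms rearrange_multiindices[of N \<rho>] by (auto simp: Par_def multiindices_def fun_eq_iff)
qed

text \<open>Polynomials are only functions here, so independence has to come from evaluation. With
  the first \<open>N\<close> variables fixed, the sum is a univariate polynomial in the last
  variable that vanishes at every real, so each of its coefficients vanishes; such a coefficient is
  a sum in \<open>N\<close> variables.\<close>

lemma monomials_independent:
  assumes "finite A" "A \<subseteq> multiindices N" "\<And>x. (\<Sum>\<alpha>\<in>A. a \<alpha> * monomial N \<alpha> x) = 0" "\<alpha> \<in> A"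
  shows "a \<alpha> = 0"
  using assms
proof (induction N arbitrary: A a \<alpha>)
  case 0
  have "multiindices 0 = {\<lambda>_. 0}" by (auto simp: multiindices_def)
  with 0 have "A = {\<alpha>}" by auto
  with 0(3) show ?case by (simp add: monomial_def)
next
  case (Suc N)
  define k where "k = \<alpha> (Suc N)"
  define A' where "A' = {\<beta>\<in>A. \<beta> (Suc N) = k}"
  define r where "r = (\<lambda>\<beta>::nat\<Rightarrow>nat. \<beta>(Suc N := 0))"
  have inj: "inj_on r A'"
    by (rule inj_on_inverseI[of _ "\<lambda>\<beta>. \<beta>(Suc N := k)"]) (auto simp: r_def A'_def fun_eq_iff)
  have mon: "monomial (Suc N) \<beta> x = monomial N \<beta> x * x (Suc N) ^ \<beta> (Suc N)" for \<beta> and x :: "nat \<Rightarrow> real"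
    by (simp add: monomial_def)
  have monupd: "monomial N \<beta> (x(Suc N := s)) = monomial N \<beta> x" for \<beta> s and x :: "nat \<Rightarrow> real"
    unfolding monomial_def by (rule prod.cong) auto
  have monr: "monomial N (r \<beta>) x = monomial N \<beta> x" for \<beta> and x :: "nat \<Rightarrow> real"
    unfolding monomial_def r_def by (rule prod.cong) auto
  have zero: "(\<Sum>\<beta>\<in>A'. a \<beta> * monomial N \<beta> x) = 0" for x :: "nat \<Rightarrow> real"
  proof -
    define p where "p = (\<Sum>\<beta>\<in>A. Polynomial.monom (a \<beta> * monomial N \<beta> x) (\<beta> (Suc N)))"
    have "poly p s = 0" for s
      using Suc.prems(3)[of "x(Suc N := s)"]
      by (simp add: p_def poly_sum poly_monom mon monupd mult.assoc del: fun_upd_apply) (simp add: fun_upd_def)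
    then have "p = 0" using poly_all_0_iff_0 by blast
    then have "coeff p k = 0" by simp
    then show ?thesis
      using Suc.prems(1) by (simp add: p_def coeff_sum A'_def sum.inter_filter)
  qed
  \<comment> \<open>\<open>r\<close> drops the last exponent and is injective on \<open>A'\<close>,
    where that exponent is \<open>k\<close>; the coefficients are transported along it to apply the
    induction hypothesis.\<close>
  have "a (inv_into A' r (r \<alpha>)) = 0"
  proof (rule Suc.IH[of "r ` A'" "\<lambda>\<beta>. a (inv_into A' r \<beta>)" "r \<alpha>"])
    show "finite (r ` A')" using Suc.prems(1) by (simp add: A'_def)
    show "r ` A' \<subseteq> multiindices N"
      using Suc.prems(2) by (fastforce simp: A'_def r_def multiindices_def)
    show "(\<Sum>\<beta>\<in>r ` A'. a (inv_into A' r \<beta>) * monomial N \<beta> x) = 0" for x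
      using zero[of x] by (simp add: sum.reindex[OF inj] inv_into_f_f[OF inj] monr)
    show "r \<alpha> \<in> r ` A'" using Suc.prems(4) by (simp add: A'_def k_def)
  qed
  then show ?case using inv_into_f_f[OF inj] Suc.prems(4) by (simp add: A'_def k_def)
qed

text \<open>Values of \<open>a\<close> off \<open>hom_indices N n\<close> are unconstrained, so
  coefficients are unique only on that set.\<close>

definition poly_rep :: "nat \<Rightarrow> nat \<Rightarrow> ((nat \<Rightarrow> nat) \<Rightarrow> real) \<Rightarrow> ((nat \<Rightarrow> real) \<Rightarrow> real) \<Rightarrow> bool" where
  "poly_rep N n a F \<longleftrightarrow> (\<forall>x. F x = (\<Sum>\<alpha>\<in>hom_indices N n. a \<alpha> * monomial N \<alpha> x))"

lemma poly_rep_unique: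
  assumes "poly_rep N n a F" "poly_rep N n b F" "\<alpha> \<in> hom_indices N n"
  shows "a \<alpha> = b \<alpha>"
proof -
  have "(\<Sum>\<alpha>\<in>hom_indices N n. (a \<alpha> - b \<alpha>) * monomial N \<alpha> x) = 0" for x
    using assms(1,2) by (simp add: poly_rep_def left_diff_distrib sum_subtractf)
  then have "a \<alpha> - b \<alpha> = 0"
    using monomials_independent[OF finite_hom_indices _ _ assms(3), of N "\<lambda>\<alpha>. a \<alpha> - b \<alpha>"]
    by (auto simp: hom_indices_def)
  then show ?thesis by simp
qed

text \<open>Symmetry is imposed on the coefficients rather than on the induced function, so that it
  passes through multiplication by power sums by reindexing alone.\<close>

definition symmetric_coeffs :: "nat \<Rightarrow> ((nat \<Rightarrow> nat) \<Rightarrow> real) \<Rightarrow> bool" where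
  "symmetric_coeffs N a \<longleftrightarrow> (\<forall>\<alpha>\<in>multiindices N. \<forall>\<pi>. \<pi> permutes {1..N} \<longrightarrow> a (\<alpha> \<circ> \<pi>) = a \<alpha>)"

lemma symmetric_coeffs_rearrange:
  assumes "symmetric_coeffs N a" "\<alpha> \<in> multiindices N"
  shows "a (rearrange N \<alpha>) = a \<alpha>"
  using assms ex_rearrange_permutes[OF assms(2)] unfolding symmetric_coeffs_def by metis

text \<open>Monomials are grouped by their sorted exponent vector: the fibre of
  \<open>rearrange\<close> over a partition \<rho> is exactly the set of monomials of
  m_\<rho>.\<close>

lemma msym_sum_rep: "poly_rep N n (\<lambda>\<alpha>. c (rearrange N \<alpha>)) (\<lambda>x. \<Sum>\<rho>\<in>Par N n. c \<rho> * msym N \<rho> x)"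
  unfolding poly_rep_def
proof
  fix x
  have ms: "msym N \<rho> x = (\<Sum>\<alpha> | \<alpha> \<in> hom_indices N n \<and> rearrange N \<alpha> = \<rho>. monomial N \<alpha> x)"
    if "\<rho> \<in> Par N n" for \<rho>
  proof -
    have "{\<alpha> \<in> multiindices N. rearrange N \<alpha> = \<rho>} = {\<alpha> \<in> hom_indices N n. rearrange N \<alpha> = \<rho>}"
      using that weight_rearrange by (force simp: hom_indices_def Par_def)
    then show ?thesis by (simp add: msym_def)
  qed
  have "(\<Sum>\<alpha>\<in>hom_indices N n. c (rearrange N \<alpha>) * monomial N \<alpha> x) =
    (\<Sum>\<rho>\<in>Par N n. \<Sum>\<alpha> | \<alpha> \<in> hom_indices N n \<and> rearrange N \<alpha> = \<rho>. c (rearrange N \<alpha>) * monomial N \<alpha> x)"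
    by (rule sum.group[symmetric]) (auto simp: finite_hom_indices finite_Par rearrange_in_Par)
  also have "\<dots> = (\<Sum>\<rho>\<in>Par N n. c \<rho> * msym N \<rho> x)"
    by (rule sum.cong) (auto simp: ms sum_distrib_left)
  finally show "(\<Sum>\<rho>\<in>Par N n. c \<rho> * msym N \<rho> x) = (\<Sum>\<alpha>\<in>hom_indices N n. c (rearrange N \<alpha>) * monomial N \<alpha> x)"
    by simp
qed

lemma symmetric_rep_msym_sum:
  assumes "symmetric_coeffs N a" "poly_rep N n a F"
  shows "F x = (\<Sum>\<rho>\<in>Par N n. a \<rho> * msym N \<rho> x)"
proof -
  have "F x = (\<Sum>\<alpha>\<in>hom_indices N n. a (rearrange N \<alpha>) * monomial N \<alpha> x)"
    using assms(2) symmetric_coeffs_rearrange[OF assms(1)]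
    by (auto simp: poly_rep_def hom_indices_def intro!: sum.cong)
  then show ?thesis using msym_sum_rep[of N n a] by (simp add: poly_rep_def)
qed

lemma symmetric_coeffs_comp_rearrange: "symmetric_coeffs N (\<lambda>\<alpha>. c (rearrange N \<alpha>))"
  by (simp add: symmetric_coeffs_def rearrange_permutes)

lemma msym_sum_unique:
  assumes "\<And>x. (\<Sum>\<rho>\<in>Par N n. c \<rho> * msym N \<rho> x) = (\<Sum>\<rho>\<in>Par N n. d \<rho> * msym N \<rho> x)"
    and "\<rho> \<in> Par N n"
  shows "c \<rho> = d \<rho>"
proof -
  have "c (rearrange N \<rho>) = d (rearrange N \<rho>)"
  proof (rule poly_rep_unique[OF msym_sum_rep[of N n c]])
    show "poly_rep N n (\<lambda>\<alpha>. d (rearrange N \<alpha>)) (\<lambda>x. \<Sum>\<rho>\<in>Par N n. c \<rho> * msym N \<rho> x)"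
      unfolding assms(1) by (rule msym_sum_rep)
    show "\<rho> \<in> hom_indices N n" using assms(2) Par_subset_hom_indices by blast
  qed
  then show ?thesis using rearrange_Par[OF assms(2)] by simp
qed

section \<open>Multiplication by power sums, on coefficients\<close>

definition power_sum :: "nat \<Rightarrow> nat \<Rightarrow> (nat \<Rightarrow> real) \<Rightarrow> real" where
  "power_sum N m x = (\<Sum>i=1..N. x i ^ m)"

lemma power_sum_1: "power_sum N 1 = e1 N"
  by (simp add: power_sum_def e1_def fun_eq_iff)

text \<open>In p_m F the monomial x^\<alpha> arises from x_i^m times the monomial whose i-th
  exponent is smaller by m; the guard keeps truncated subtraction from producing false
  predecessors.\<close>

definition power_sum_mult :: "nat \<Rightarrow> nat \<Rightarrow> ((nat \<Rightarrow> nat) \<Rightarrow> real) \<Rightarrow> (nat \<Rightarrow> nat) \<Rightarrow> real" where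
  "power_sum_mult N m a \<alpha> = (\<Sum>i=1..N. if m \<le> \<alpha> i then a (\<alpha>(i := \<alpha> i - m)) else 0)"

lemma weight_upd:
  assumes "i \<in> {1..N}"
  shows "weight N (\<alpha>(i := v)) + \<alpha> i = weight N \<alpha> + v"
proof -
  have "(\<Sum>j\<in>{1..N} - {i}. (\<alpha>(i := v)) j) = (\<Sum>j\<in>{1..N} - {i}. \<alpha> j)"
    by (rule sum.cong) auto
  then show ?thesis
    using assms by (simp add: weight_def sum.remove[of "{1..N}" i] del: One_nat_def)
qed

lemma monomial_upd:
  assumes "i \<in> {1..N}"
  shows "monomial N (\<alpha>(i := \<alpha> i + m)) x = x i ^ m * monomial N \<alpha> x"
proof -
  have "(\<Prod>j\<in>{1..N} - {i}. x j ^ (\<alpha>(i := \<alpha> i + m)) j) = (\<Prod>j\<in>{1..N} - {i}. x j ^ \<alpha> j)"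
    by (rule prod.cong) auto
  then show ?thesis
    using assms by (simp add: monomial_def prod.remove[of "{1..N}" i] power_add del: One_nat_def)
qed

lemma power_sum_mult_rep:
  assumes "poly_rep N n a F"
  shows "poly_rep N (n + m) (power_sum_mult N m a) (\<lambda>x. power_sum N m x * F x)"
  unfolding poly_rep_def
proof
  fix x
  have *: "(\<Sum>\<alpha>\<in>hom_indices N n. x i ^ m * (a \<alpha> * monomial N \<alpha> x)) =
    (\<Sum>\<alpha>\<in>hom_indices N (n + m). (if m \<le> \<alpha> i then a (\<alpha>(i := \<alpha> i - m)) else 0) * monomial N \<alpha> x)"
    if i: "i \<in> {1..N}" for i
  proof -
    have "(\<Sum>\<alpha>\<in>hom_indices N n. x i ^ m * (a \<alpha> * monomial N \<alpha> x)) =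
      (\<Sum>\<alpha> | \<alpha> \<in> hom_indices N (n + m) \<and> m \<le> \<alpha> i. a (\<alpha>(i := \<alpha> i - m)) * monomial N \<alpha> x)"
    proof (rule sum.reindex_bij_witness[where j="\<lambda>\<alpha>. \<alpha>(i := \<alpha> i + m)" and i="\<lambda>\<alpha>. \<alpha>(i := \<alpha> i - m)"])
      fix \<alpha> assume a: "\<alpha> \<in> hom_indices N n"
      show "\<alpha>(i := \<alpha> i + m) \<in> {\<alpha>. \<alpha> \<in> hom_indices N (n + m) \<and> m \<le> \<alpha> i}"
        using a i weight_upd[OF i, of \<alpha> "\<alpha> i + m"] by (auto simp: hom_indices_def multiindices_def)
      show "a ((\<alpha>(i := \<alpha> i + m))(i := (\<alpha>(i := \<alpha> i + m)) i - m)) * monomial N (\<alpha>(i := \<alpha> i + m)) x =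
        x i ^ m * (a \<alpha> * monomial N \<alpha> x)"
        by (simp add: monomial_upd[OF i])
    next
      fix \<alpha> assume a: "\<alpha> \<in> {\<alpha>. \<alpha> \<in> hom_indices N (n + m) \<and> m \<le> \<alpha> i}"
      then show "\<alpha>(i := \<alpha> i - m) \<in> hom_indices N n"
        using i weight_upd[OF i, of \<alpha> "\<alpha> i - m"] by (auto simp: hom_indices_def multiindices_def)
    qed auto
    also have "\<dots> = (\<Sum>\<alpha>\<in>hom_indices N (n + m). if m \<le> \<alpha> i then a (\<alpha>(i := \<alpha> i - m)) * monomial N \<alpha> x else 0)"
      by (rule sum.inter_filter) (rule finite_hom_indices)
    also have "\<dots> = (\<Sum>\<alpha>\<in>hom_indices N (n + m). (if m \<le> \<alpha> i then a (\<alpha>(i := \<alpha> i - m)) else 0) * monomial N \<alpha> x)"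
      by (rule sum.cong) auto
    finally show ?thesis .
  qed
  have "power_sum N m x * F x = (\<Sum>i=1..N. \<Sum>\<alpha>\<in>hom_indices N n. x i ^ m * (a \<alpha> * monomial N \<alpha> x))"
    unfolding power_sum_def sum_distrib_right
    using assms by (simp add: poly_rep_def sum_distrib_left)
  also have "\<dots> = (\<Sum>i=1..N. \<Sum>\<alpha>\<in>hom_indices N (n + m).
      (if m \<le> \<alpha> i then a (\<alpha>(i := \<alpha> i - m)) else 0) * monomial N \<alpha> x)"
    by (rule sum.cong) (auto simp: *)
  also have "\<dots> = (\<Sum>\<alpha>\<in>hom_indices N (n + m). power_sum_mult N m a \<alpha> * monomial N \<alpha> x)"
    by (subst sum.swap) (simp add: power_sum_mult_def sum_distrib_right)
  finally show "power_sum N m x * F x = (\<Sum>\<alpha>\<in>hom_indices N (n + m). power_sum_mult N m a \<alpha> * monomial N \<alpha> x)" .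
qed

lemma power_sum_mult_symmetric:
  assumes "symmetric_coeffs N a"
  shows "symmetric_coeffs N (power_sum_mult N m a)"
  unfolding symmetric_coeffs_def
proof (intro ballI allI impI)
  fix \<alpha> \<pi> assume \<alpha>: "\<alpha> \<in> multiindices N" and \<pi>: "\<pi> permutes {1..N}"
  have "(if m \<le> (\<alpha> \<circ> \<pi>) i then a ((\<alpha> \<circ> \<pi>)(i := (\<alpha> \<circ> \<pi>) i - m)) else 0) =
    (if m \<le> \<alpha> (\<pi> i) then a (\<alpha>(\<pi> i := \<alpha> (\<pi> i) - m)) else 0)" if i: "i \<in> {1..N}" for i
  proof -
    have "(\<alpha> \<circ> \<pi>)(i := (\<alpha> \<circ> \<pi>) i - m) = (\<alpha>(\<pi> i := \<alpha> (\<pi> i) - m)) \<circ> \<pi>"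
      using permutes_inj[OF \<pi>] by (auto simp: fun_eq_iff inj_def)
    moreover have "\<pi> i \<in> {1..N}" using i \<pi> by (simp only: permutes_in_image)
    then have "\<alpha>(\<pi> i := \<alpha> (\<pi> i) - m) \<in> multiindices N"
      using \<alpha> by (auto simp: multiindices_def)
    ultimately show ?thesis using assms \<pi> by (simp add: symmetric_coeffs_def)
  qed
  then have "power_sum_mult N m a (\<alpha> \<circ> \<pi>) =
      (\<Sum>i=1..N. if m \<le> \<alpha> (\<pi> i) then a (\<alpha>(\<pi> i := \<alpha> (\<pi> i) - m)) else 0)"
    unfolding power_sum_mult_def by (intro sum.cong) auto
  also have "\<dots> = power_sum_mult N m a \<alpha>"
    unfolding power_sum_mult_def
    using sum.permute[OF \<pi>, of "\<lambda>i. if m \<le> \<alpha> i then a (\<alpha>(i := \<alpha> i - m)) else 0"] by (simp add: comp_def)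
  finally show "power_sum_mult N m a (\<alpha> \<circ> \<pi>) = power_sum_mult N m a \<alpha>" .
qed

subsection \<open>The basis given by the modified monomial symmetric functions\<close>

text \<open>
  For partitions \<open>\<sigma>\<close> and \<open>\<alpha>\<close> this means \<open>\<sigma> i \<le> \<alpha> i\<close> for all \<open>i\<close>; phrased by counting, it is visibly
  monotone in \<open>\<alpha>\<close> and invariant under permuting \<open>\<alpha>\<close>.
\<close>

definition dominates :: "nat \<Rightarrow> (nat \<Rightarrow> nat) \<Rightarrow> (nat \<Rightarrow> nat) \<Rightarrow> bool" where
  "dominates N \<sigma> \<alpha> \<longleftrightarrow> (\<forall>i\<in>{1..N}. i \<le> card {j\<in>{1..N}. \<sigma> i \<le> \<alpha> j})"

lemma dominates_mono:
  assumes "dominates N \<sigma> \<alpha>" "\<And>j. \<alpha> j \<le> \<beta> j"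
  shows "dominates N \<sigma> \<beta>"
  unfolding dominates_def
proof
  fix i assume "i \<in> {1..N}"
  then have "i \<le> card {j\<in>{1..N}. \<sigma> i \<le> \<alpha> j}"
    using assms(1) by (simp only: dominates_def)
  also have "\<dots> \<le> card {j\<in>{1..N}. \<sigma> i \<le> \<beta> j}"
    using assms(2) order_trans by (intro card_mono) auto
  finally show "i \<le> card {j\<in>{1..N}. \<sigma> i \<le> \<beta> j}" .
qed

lemma dominates_permutes:
  assumes "dominates N \<sigma> (\<alpha> \<circ> \<pi>)" "\<pi> permutes {1..N}"
  shows "dominates N \<sigma> \<alpha>"
  unfolding dominates_def
proof
  fix i assume "i \<in> {1..N}"
  then have "i \<le> card {j\<in>{1..N}. \<sigma> i \<le> \<alpha> (\<pi> j)}"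
    using assms(1) by (simp only: dominates_def comp_def)
  also have "\<dots> = card (\<pi> ` {j\<in>{1..N}. \<sigma> i \<le> \<alpha> (\<pi> j)})"
    using permutes_inj_on[OF assms(2)] by (simp add: card_image)
  also have "\<dots> \<le> card {j\<in>{1..N}. \<sigma> i \<le> \<alpha> j}"
    using permutes_in_image[OF assms(2)] by (intro card_mono) auto
  finally show "i \<le> card {j\<in>{1..N}. \<sigma> i \<le> \<alpha> j}" .
qed

lemma dominates_self:
  assumes "\<sigma> \<in> Par N n"
  shows "dominates N \<sigma> \<sigma>"
  unfolding dominates_def
proof
  fix i assume i: "i \<in> {1..N}"
  have "i = card {1..i}" by simp
  also have "\<dots> \<le> card {j\<in>{1..N}. \<sigma> i \<le> \<sigma> j}"
    using assms i by (intro card_mono) (auto simp: Par_def)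
  finally show "i \<le> card {j\<in>{1..N}. \<sigma> i \<le> \<sigma> j}" .
qed

text \<open>If \<nu>_i < \<sigma>_i, then, \<nu> being nonincreasing, only the i - 1 indices below i
  can have an entry \<ge> \<sigma>_i, which is one too few for the count.\<close>

lemma dominates_Par:
  assumes "\<nu> \<in> Par N n" "dominates N \<sigma> \<nu>" "i \<in> {1..N}"
  shows "\<sigma> i \<le> \<nu> i"
proof (rule ccontr)
  assume c: "\<not> \<sigma> i \<le> \<nu> i"
  have "{j\<in>{1..N}. \<sigma> i \<le> \<nu> j} \<subseteq> {1..<i}"
  proof
    fix j assume j: "j \<in> {j\<in>{1..N}. \<sigma> i \<le> \<nu> j}"
    have "\<not> i \<le> j"
    proof
      assume "i \<le> j"
      then have "\<nu> j \<le> \<nu> i" using assms(1,3) j unfolding Par_def by blast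
      then show False using c j by simp
    qed
    then show "j \<in> {1..<i}" using j by auto
  qed
  then have "card {j\<in>{1..N}. \<sigma> i \<le> \<nu> j} \<le> card {1..<i}" by (intro card_mono) auto
  moreover have "i \<le> card {j\<in>{1..N}. \<sigma> i \<le> \<nu> j}"
    using assms(2,3) by (simp only: dominates_def)
  ultimately show False using assms(3) by auto
qed

lemma msym_rep:
  assumes "\<sigma> \<in> Par N n"
  shows "poly_rep N n (\<lambda>\<alpha>. if rearrange N \<alpha> = \<sigma> then 1 else 0) (msym N \<sigma>)"
proof -
  have "(\<lambda>x. \<Sum>\<rho>\<in>Par N n. (if \<rho> = \<sigma> then 1 else 0) * msym N \<rho> x) = msym N \<sigma>"
    using assms by (intro ext) (simp add: finite_Par mult_delta_left)
  then show ?thesis using msym_sum_rep[of N n "\<lambda>\<rho>. if \<rho> = \<sigma> then 1 else 0"] by simp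
qed

text \<open>This is the source of triangularity. Multiplication by e_1 only raises exponents, so
  domination of \<sigma> persists. Nonnegativity is carried along because it excludes cancellation:
  the coefficient at the raised \<sigma> is then bounded below by the single summand that raises the
  first exponent.\<close>

lemma e1_power_msym_rep:
  assumes N: "N \<ge> 1" and \<sigma>: "\<sigma> \<in> Par N n"
  shows "\<exists>a. symmetric_coeffs N a \<and> poly_rep N (n + d) a (\<lambda>x. e1 N x ^ d * msym N \<sigma> x) \<and>
    (\<forall>\<alpha>. a \<alpha> \<ge> 0) \<and> (\<forall>\<alpha>\<in>multiindices N. a \<alpha> \<noteq> 0 \<longrightarrow> dominates N \<sigma> \<alpha>) \<and> a (\<sigma>(1 := \<sigma> 1 + d)) > 0"
proof (induction d)
  case 0
  let ?a = "\<lambda>\<alpha>. if rearrange N \<alpha> = \<sigma> then 1 else 0 :: real"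
  have "symmetric_coeffs N ?a" by (rule symmetric_coeffs_comp_rearrange)
  moreover have "dominates N \<sigma> \<alpha>" if "\<alpha> \<in> multiindices N" "rearrange N \<alpha> = \<sigma>" for \<alpha>
    using ex_rearrange_permutes[OF that(1)] that(2) dominates_self[OF \<sigma>] dominates_permutes by metis
  ultimately show ?case
    using msym_rep[OF \<sigma>] rearrange_Par[OF \<sigma>] by (intro exI[of _ ?a]) auto
next
  case (Suc d)
  then obtain a where a: "symmetric_coeffs N a" "poly_rep N (n + d) a (\<lambda>x. e1 N x ^ d * msym N \<sigma> x)"
    "\<And>\<alpha>. a \<alpha> \<ge> 0" "\<And>\<alpha>. \<alpha> \<in> multiindices N \<Longrightarrow> a \<alpha> \<noteq> 0 \<Longrightarrow> dominates N \<sigma> \<alpha>" "a (\<sigma>(1 := \<sigma> 1 + d)) > 0"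
    by blast
  let ?b = "power_sum_mult N 1 a"
  have "poly_rep N (n + Suc d) ?b (\<lambda>x. e1 N x ^ Suc d * msym N \<sigma> x)"
    using power_sum_mult_rep[OF a(2), of 1] by (simp add: power_sum_1[unfolded One_nat_def] mult.assoc)
  moreover have "?b \<alpha> \<ge> 0" for \<alpha>
    unfolding power_sum_mult_def by (intro sum_nonneg) (simp add: a(3))
  moreover have "dominates N \<sigma> \<alpha>" if \<alpha>: "\<alpha> \<in> multiindices N" "?b \<alpha> \<noteq> 0" for \<alpha>
  proof -
    obtain i where i: "i \<in> {1..N}" "(if 1 \<le> \<alpha> i then a (\<alpha>(i := \<alpha> i - 1)) else 0) \<noteq> 0"
      using \<alpha>(2) unfolding power_sum_mult_def
      by (rule sum.not_neutral_contains_not_neutral)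
    then have "a (\<alpha>(i := \<alpha> i - 1)) \<noteq> 0" by (auto split: if_splits)
    moreover have "\<alpha>(i := \<alpha> i - 1) \<in> multiindices N"
      using \<alpha>(1) i(1) by (auto simp: multiindices_def)
    ultimately have "dominates N \<sigma> (\<alpha>(i := \<alpha> i - 1))" using a(4) by blast
    then show ?thesis by (rule dominates_mono) auto
  qed
  moreover have "?b (\<sigma>(1 := \<sigma> 1 + Suc d)) > 0"
  proof -
    let ?\<alpha> = "\<sigma>(1 := \<sigma> 1 + Suc d)"
    have "0 < a (\<sigma>(1 := \<sigma> 1 + d))" by (rule a(5))
    also have "\<dots> = (if 1 \<le> ?\<alpha> 1 then a (?\<alpha>(1 := ?\<alpha> 1 - 1)) else 0)" by simp
    also have "\<dots> \<le> ?b ?\<alpha>"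
      unfolding power_sum_mult_def using N
      by (intro member_le_sum[of 1 "{1..N}" "\<lambda>i. if 1 \<le> ?\<alpha> i then a (?\<alpha>(i := ?\<alpha> i - 1)) else 0"])
        (auto simp: a(3))
    finally show ?thesis .
  qed
  ultimately show ?case
    using power_sum_mult_symmetric[OF a(1), of 1] by blast
qed

section \<open>Triangularity between the two bases, and the coefficients B\<close>

lemma Par_le:
  assumes "\<rho> \<in> Par N n" "i \<in> {1..N}" "j \<in> {1..N}" "i \<le> j"
  shows "\<rho> j \<le> \<rho> i"
  using assms unfolding Par_def by blast

lemma Par_weight: "\<rho> \<in> Par N n \<Longrightarrow> weight N \<rho> = n"
  by (simp add: Par_def)

lemma Par_outside: "\<rho> \<in> Par N n \<Longrightarrow> i \<notin> {1..N} \<Longrightarrow> \<rho> i = 0"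
  by (auto simp: Par_def multiindices_def)

lemma Par_reduce_first:
  assumes "N \<ge> 2" "\<rho> \<in> Par N n" "v \<ge> \<rho> 2" "v \<le> \<rho> 1"
  shows "\<rho>(1 := v) \<in> Par N (n - (\<rho> 1 - v))"
proof -
  have "weight N (\<rho>(1 := v)) + \<rho> 1 = n + v"
    using weight_upd[of 1 N \<rho> v] assms(1) Par_weight[OF assms(2)] by simp
  then have w: "weight N (\<rho>(1 := v)) = n - (\<rho> 1 - v)" using assms(4) by simp
  have "(\<rho>(1 := v)) j \<le> (\<rho>(1 := v)) i" if "i \<in> {1..N}" "j \<in> {1..N}" "i \<le> j" for i j
  proof (cases "j = 1 \<or> i \<noteq> 1")
    case True
    then show ?thesis using that Par_le[OF assms(2), of i j] by auto
  next
    case False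
    then have "\<rho> j \<le> \<rho> 2" using that assms(1) by (intro Par_le[OF assms(2)]) auto
    then show ?thesis using False assms(3) by auto
  qed
  moreover have "\<rho>(1 := v) \<in> multiindices N"
    using assms(1,2) by (auto simp: Par_def multiindices_def)
  ultimately show ?thesis using w unfolding Par_def by blast
qed

lemma Par_raise_first:
  assumes "N \<ge> 1" "\<rho> \<in> Par N n"
  shows "\<rho>(1 := \<rho> 1 + d) \<in> Par N (n + d)"
proof -
  have "weight N (\<rho>(1 := \<rho> 1 + d)) = n + d"
    using weight_upd[of 1 N \<rho> "\<rho> 1 + d"] assms(1) Par_weight[OF assms(2)] by simp
  moreover have "(\<rho>(1 := \<rho> 1 + d)) j \<le> (\<rho>(1 := \<rho> 1 + d)) i" if "i \<in> {1..N}" "j \<in> {1..N}" "i \<le> j" for i j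
    using that Par_le[OF assms(2), of i j] by auto
  moreover have "\<rho>(1 := \<rho> 1 + d) \<in> multiindices N"
    using assms by (auto simp: Par_def multiindices_def)
  ultimately show ?thesis unfolding Par_def by blast
qed

lemma Par_first_ge_second:
  assumes "N \<ge> 2" "\<rho> \<in> Par N n"
  shows "\<rho> 2 \<le> \<rho> 1"
  using Par_le[OF assms(2), of 1 2] assms(1) by simp

text \<open>The previous construction is applied to \<sigma> = (\<rho>_2, \<rho>_2, \<rho>_3, ...)
  with \<rho>_1 - \<rho>_2 factors e_1, so the raised \<sigma> is \<rho> itself. Every \<nu> that
  occurs dominates \<sigma>, which from the second component on is the condition in
  \<open>prec_eq N \<nu> \<rho>\<close>.\<close>

lemma msym_tilde_expansion:
  assumes N: "N \<ge> 2" and \<rho>: "\<rho> \<in> Par N n"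
  shows "\<exists>a. (\<forall>x. msym_tilde N \<rho> x = (\<Sum>\<nu>\<in>Par N n. a \<nu> * msym N \<nu> x)) \<and> a \<rho> > 0 \<and>
    (\<forall>\<nu>\<in>Par N n. a \<nu> \<noteq> 0 \<longrightarrow> prec_eq N \<nu> \<rho>)"
proof -
  let ?\<sigma> = "\<rho>(1 := \<rho> 2)" and ?d = "\<rho> 1 - \<rho> 2"
  note ge = Par_first_ge_second[OF N \<rho>]
  have \<sigma>: "?\<sigma> \<in> Par N (n - ?d)" using N \<rho> ge by (intro Par_reduce_first) auto
  have "\<rho> 1 \<le> weight N \<rho>"
    unfolding weight_def using N by (intro member_le_sum) auto
  \<comment> \<open>The subtraction is not truncated because \<rho>_1 \<le> n.\<close>
  then have n: "n - ?d + ?d = n" using Par_weight[OF \<rho>] by simp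
  have e: "?\<sigma>(1 := ?\<sigma> 1 + ?d) = \<rho>" using ge by auto
  obtain a where a: "symmetric_coeffs N a" "poly_rep N n a (\<lambda>x. e1 N x ^ ?d * msym N ?\<sigma> x)"
    "\<And>\<alpha>. \<alpha> \<in> multiindices N \<Longrightarrow> a \<alpha> \<noteq> 0 \<Longrightarrow> dominates N ?\<sigma> \<alpha>" "a \<rho> > 0"
    using e1_power_msym_rep[OF _ \<sigma>, of ?d] N unfolding n e by auto
  have "prec_eq N \<nu> \<rho>" if \<nu>: "\<nu> \<in> Par N n" "a \<nu> \<noteq> 0" for \<nu>
  proof -
    have "dominates N ?\<sigma> \<nu>" using a(3) \<nu> by (simp add: Par_def)
    then have *: "?\<sigma> i \<le> \<nu> i" if "i \<in> {1..N}" for i using dominates_Par \<nu>(1) that by blast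
    have "\<rho> i \<le> \<nu> i" if "i \<ge> 2" for i
      using *[of i] that Par_outside[OF \<rho>, of i] by (cases "i \<in> {1..N}") auto
    then show ?thesis using \<nu>(1) \<rho> by (simp add: prec_eq_def Par_weight)
  qed
  moreover have "msym_tilde N \<rho> x = (\<Sum>\<nu>\<in>Par N n. a \<nu> * msym N \<nu> x)" for x
    using symmetric_rep_msym_sum[OF a(1,2)] by (simp add: msym_tilde_def)
  ultimately show ?thesis using a(4) by blast
qed

text \<open>At equal weight a larger tail leaves a smaller first part, and equal first parts leave
  no room for a strict inequality in the tail. The first part thus serves as the rank in the
  triangular arguments.\<close>

lemma prec_eq_first:
  assumes "N \<ge> 1" "\<mu> \<in> Par N n" "\<nu> \<in> Par N n" "prec_eq N \<mu> \<nu>"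
  shows "\<mu> 1 \<le> \<nu> 1" "\<mu> 1 = \<nu> 1 \<Longrightarrow> \<mu> = \<nu>"
proof -
  have split: "weight N \<alpha> = \<alpha> 1 + (\<Sum>i=2..N. \<alpha> i)" for \<alpha>
    unfolding weight_def using assms(1) by (simp add: sum.atLeast_Suc_atMost numeral_2_eq_2)
  have le: "(\<Sum>i=2..N. \<nu> i) \<le> (\<Sum>i=2..N. \<mu> i)"
    using assms(4) by (intro sum_mono) (auto simp: prec_eq_def)
  then show "\<mu> 1 \<le> \<nu> 1"
    using split[of \<mu>] split[of \<nu>] assms(2,3) by (simp add: Par_weight)
  show "\<mu> = \<nu>" if "\<mu> 1 = \<nu> 1"
  proof
    fix i
    have eq: "(\<Sum>i=2..N. \<nu> i) = (\<Sum>i=2..N. \<mu> i)"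
      using split[of \<mu>] split[of \<nu>] assms(2,3) that by (simp add: Par_weight)
    have "\<mu> i = \<nu> i" if "i \<in> {2..N}"
      using sum_mono_inv[OF eq _ that] assms(4) by (auto simp: prec_eq_def)
    then show "\<mu> i = \<nu> i"
      using \<open>\<mu> 1 = \<nu> 1\<close> Par_outside[OF assms(2), of i] Par_outside[OF assms(3), of i]
      by (cases "i = 1"; cases "i \<in> {1..N}") auto
  qed
qed

lemma prec_eq_trans: "prec_eq N \<mu> \<nu> \<Longrightarrow> prec_eq N \<nu> \<rho> \<Longrightarrow> prec_eq N \<mu> \<rho>"
  unfolding prec_eq_def using order_trans by metis

text \<open>Among the \<nu> with \<open>d \<nu> \<noteq> 0\<close>, take \<mu> with largest first
  part. The coefficient at m_\<mu> can only receive contributions from \<nu> with \<mu> \<preceq>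
  \<nu>, hence \<nu>_1 \<ge> \<mu>_1; maximality leaves \<nu> = \<mu>, whose diagonal coefficient is
  positive.\<close>

lemma msym_tilde_independent:
  assumes N: "N \<ge> 2" and zero: "\<And>x. (\<Sum>\<nu>\<in>Par N n. d \<nu> * msym_tilde N \<nu> x) = 0" and \<rho>: "\<rho> \<in> Par N n"
  shows "d \<rho> = 0"
proof (rule ccontr)
  assume "d \<rho> \<noteq> 0"
  define S where "S = {\<nu>\<in>Par N n. d \<nu> \<noteq> 0}"
  have S: "finite S" "S \<noteq> {}" using \<rho> \<open>d \<rho> \<noteq> 0\<close> by (auto simp: S_def finite_Par)
  have "Max ((\<lambda>\<nu>. \<nu> 1) ` S) \<in> (\<lambda>\<nu>. \<nu> 1) ` S" using S by (intro Max_in) auto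
  then obtain \<mu> where \<mu>: "\<mu> \<in> S" and eq: "Max ((\<lambda>\<nu>. \<nu> 1) ` S) = \<mu> 1" by (rule imageE)
  have max: "\<nu> 1 \<le> \<mu> 1" if "\<nu> \<in> S" for \<nu>
    unfolding eq[symmetric] using S(1) that by (intro Max_ge) auto
  let ?P = "\<lambda>\<nu> a. (\<forall>x. msym_tilde N \<nu> x = (\<Sum>\<tau>\<in>Par N n. a \<tau> * msym N \<tau> x)) \<and> a \<nu> > 0 \<and>
      (\<forall>\<tau>\<in>Par N n. a \<tau> \<noteq> 0 \<longrightarrow> prec_eq N \<tau> \<nu>)"
  have "\<forall>\<nu>\<in>Par N n. \<exists>a. ?P \<nu> a" by (intro ballI msym_tilde_expansion[OF N])
  then have "\<exists>A. \<forall>\<nu>\<in>Par N n. ?P \<nu> (A \<nu>)" by (rule bchoice)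
  then obtain A where A': "\<forall>\<nu>\<in>Par N n. ?P \<nu> (A \<nu>)" by (rule exE)
  have A: "msym_tilde N \<nu> x = (\<Sum>\<tau>\<in>Par N n. A \<nu> \<tau> * msym N \<tau> x)" "A \<nu> \<nu> > 0"
    "\<tau> \<in> Par N n \<Longrightarrow> A \<nu> \<tau> \<noteq> 0 \<Longrightarrow> prec_eq N \<tau> \<nu>" if "\<nu> \<in> Par N n" for \<nu> \<tau> x
    using A' that by auto
  have "(\<Sum>\<tau>\<in>Par N n. (\<Sum>\<nu>\<in>Par N n. d \<nu> * A \<nu> \<tau>) * msym N \<tau> x) = (\<Sum>\<tau>\<in>Par N n. 0 * msym N \<tau> x)" for x
  proof -
    have "(\<Sum>\<tau>\<in>Par N n. (\<Sum>\<nu>\<in>Par N n. d \<nu> * A \<nu> \<tau>) * msym N \<tau> x) =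
      (\<Sum>\<nu>\<in>Par N n. \<Sum>\<tau>\<in>Par N n. d \<nu> * A \<nu> \<tau> * msym N \<tau> x)"
      by (subst sum.swap) (simp add: sum_distrib_right)
    also have "\<dots> = (\<Sum>\<nu>\<in>Par N n. d \<nu> * msym_tilde N \<nu> x)"
      by (rule sum.cong) (auto simp: A(1) sum_distrib_left mult.assoc)
    finally show ?thesis using zero by simp
  qed
  then have "(\<Sum>\<nu>\<in>Par N n. d \<nu> * A \<nu> \<mu>) = 0"
    by (rule msym_sum_unique[where N=N and n=n and c="\<lambda>\<tau>. \<Sum>\<nu>\<in>Par N n. d \<nu> * A \<nu> \<tau>" and d="\<lambda>_. 0"])
      (use \<mu> in \<open>simp add: S_def\<close>)
  moreover have "(\<Sum>\<nu>\<in>Par N n. d \<nu> * A \<nu> \<mu>) = (\<Sum>\<nu>\<in>{\<mu>}. d \<nu> * A \<nu> \<mu>)"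
  proof (rule sum.mono_neutral_right)
    show "\<forall>\<nu>\<in>Par N n - {\<mu>}. d \<nu> * A \<nu> \<mu> = 0"
    proof (intro ballI, rule ccontr)
      fix \<nu> assume \<nu>: "\<nu> \<in> Par N n - {\<mu>}" and "d \<nu> * A \<nu> \<mu> \<noteq> 0"
      then have "\<nu> \<in> S" "prec_eq N \<mu> \<nu>" using A(3) \<mu> by (auto simp: S_def)
      then show False using prec_eq_first[of N \<mu> n \<nu>] \<mu> \<nu> N max[of \<nu>] by (auto simp: S_def)
    qed
  qed (use \<mu> in \<open>auto simp: S_def finite_Par\<close>)
  ultimately show False using A(2)[of \<mu>] \<mu> by (auto simp: S_def)
qed

lemma msym_tilde_sum_unique:
  assumes "N \<ge> 2" "\<And>x. (\<Sum>\<rho>\<in>Par N n. c \<rho> * msym_tilde N \<rho> x) = (\<Sum>\<rho>\<in>Par N n. d \<rho> * msym_tilde N \<rho> x)"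
    and "\<rho> \<in> Par N n"
  shows "c \<rho> = d \<rho>"
proof -
  have "(\<Sum>\<rho>\<in>Par N n. (c \<rho> - d \<rho>) * msym_tilde N \<rho> x) = 0" for x
    using assms(2) by (simp add: left_diff_distrib sum_subtractf)
  then have "c \<rho> - d \<rho> = 0" by (rule msym_tilde_independent[OF assms(1) _ assms(3)])
  then show ?thesis by simp
qed

text \<open>The triangular system is inverted by induction on the first part: all off-diagonal terms
  in the expansion of \<open>msym_tilde N \<rho>\<close> have a strictly smaller first part than
  \<rho>.\<close>

lemma msym_expansion:
  assumes N: "N \<ge> 2" and \<rho>: "\<rho> \<in> Par N n"
  shows "\<exists>b. (\<forall>\<nu>. b \<nu> \<noteq> 0 \<longrightarrow> \<nu> \<in> Par N n \<and> prec_eq N \<nu> \<rho>) \<and>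
    (\<forall>x. msym N \<rho> x = (\<Sum>\<nu>\<in>Par N n. b \<nu> * msym_tilde N \<nu> x))"
  using \<rho>
proof (induction "\<rho> 1" arbitrary: \<rho> rule: less_induct)
  case less
  obtain a where a': "(\<forall>x. msym_tilde N \<rho> x = (\<Sum>\<nu>\<in>Par N n. a \<nu> * msym N \<nu> x)) \<and> a \<rho> > 0 \<and>
    (\<forall>\<nu>\<in>Par N n. a \<nu> \<noteq> 0 \<longrightarrow> prec_eq N \<nu> \<rho>)"
    using msym_tilde_expansion[OF N less.prems] by (rule exE)
  then have a: "msym_tilde N \<rho> x = (\<Sum>\<nu>\<in>Par N n. a \<nu> * msym N \<nu> x)" "a \<rho> > 0"
    "\<nu> \<in> Par N n \<Longrightarrow> a \<nu> \<noteq> 0 \<Longrightarrow> prec_eq N \<nu> \<rho>" for \<nu> x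
    by auto
  define T where "T = {\<nu>\<in>Par N n. a \<nu> \<noteq> 0} - {\<rho>}"
  let ?P = "\<lambda>\<nu> b. (\<forall>\<tau>. b \<tau> \<noteq> 0 \<longrightarrow> \<tau> \<in> Par N n \<and> prec_eq N \<tau> \<nu>) \<and>
    (\<forall>x. msym N \<nu> x = (\<Sum>\<tau>\<in>Par N n. b \<tau> * msym_tilde N \<tau> x))"
  have "\<forall>\<nu>\<in>T. \<exists>b. ?P \<nu> b"
  proof
    fix \<nu> assume \<nu>: "\<nu> \<in> T"
    have "\<nu> 1 < \<rho> 1"
      using prec_eq_first[of N \<nu> n \<rho>] N \<nu> less.prems a(3)[of \<nu>] by (force simp: T_def)
    then show "\<exists>b. ?P \<nu> b" using \<nu> by (intro less.hyps) (auto simp: T_def)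
  qed
  then have "\<exists>b. \<forall>\<nu>\<in>T. ?P \<nu> (b \<nu>)" by (rule bchoice)
  then obtain b where b': "\<forall>\<nu>\<in>T. ?P \<nu> (b \<nu>)" by (rule exE)
  then have b: "b \<nu> \<tau> \<noteq> 0 \<Longrightarrow> \<tau> \<in> Par N n \<and> prec_eq N \<tau> \<nu>"
    "msym N \<nu> x = (\<Sum>\<tau>\<in>Par N n. b \<nu> \<tau> * msym_tilde N \<tau> x)" if "\<nu> \<in> T" for \<nu> \<tau> x
    using that by auto
  \<comment> \<open>Obtained by solving the expansion of \<open>msym_tilde N \<rho>\<close> for its
    diagonal term and inserting the inductive expansions of the others.\<close>
  define c where "c = (\<lambda>\<tau>. ((if \<tau> = \<rho> then 1 else 0) - (\<Sum>\<nu>\<in>T. a \<nu> * b \<nu> \<tau>)) / a \<rho>)"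
  have "msym N \<rho> x = (\<Sum>\<tau>\<in>Par N n. c \<tau> * msym_tilde N \<tau> x)" for x
  proof -
    have "msym_tilde N \<rho> x = a \<rho> * msym N \<rho> x + (\<Sum>\<nu>\<in>Par N n - {\<rho>}. a \<nu> * msym N \<nu> x)"
      using less.prems by (simp add: a(1) finite_Par sum.remove)
    also have "(\<Sum>\<nu>\<in>Par N n - {\<rho>}. a \<nu> * msym N \<nu> x) = (\<Sum>\<nu>\<in>T. a \<nu> * msym N \<nu> x)"
      by (rule sum.mono_neutral_right) (auto simp: T_def finite_Par)
    also have "\<dots> = (\<Sum>\<nu>\<in>T. \<Sum>\<tau>\<in>Par N n. a \<nu> * b \<nu> \<tau> * msym_tilde N \<tau> x)"
      by (rule sum.cong) (auto simp: b(2) sum_distrib_left mult.assoc)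
    also have "\<dots> = (\<Sum>\<tau>\<in>Par N n. (\<Sum>\<nu>\<in>T. a \<nu> * b \<nu> \<tau>) * msym_tilde N \<tau> x)"
      by (subst sum.swap) (simp add: sum_distrib_right)
    finally have *: "msym_tilde N \<rho> x = a \<rho> * msym N \<rho> x + (\<Sum>\<tau>\<in>Par N n. (\<Sum>\<nu>\<in>T. a \<nu> * b \<nu> \<tau>) * msym_tilde N \<tau> x)" .
    have "a \<rho> * (\<Sum>\<tau>\<in>Par N n. c \<tau> * msym_tilde N \<tau> x) =
      (\<Sum>\<tau>\<in>Par N n. (if \<tau> = \<rho> then 1 else 0) * msym_tilde N \<tau> x - (\<Sum>\<nu>\<in>T. a \<nu> * b \<nu> \<tau>) * msym_tilde N \<tau> x)"
      unfolding sum_distrib_left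
    proof (rule sum.cong)
      fix \<tau>
      have "a \<rho> * c \<tau> = (if \<tau> = \<rho> then 1 else 0) - (\<Sum>\<nu>\<in>T. a \<nu> * b \<nu> \<tau>)"
        using a(2) by (simp add: c_def)
      then show "a \<rho> * (c \<tau> * msym_tilde N \<tau> x) = (if \<tau> = \<rho> then 1 else 0) * msym_tilde N \<tau> x -
          (\<Sum>\<nu>\<in>T. a \<nu> * b \<nu> \<tau>) * msym_tilde N \<tau> x"
        by (simp only: mult.assoc[symmetric] left_diff_distrib)
    qed simp
    also have "\<dots> = msym_tilde N \<rho> x - (\<Sum>\<tau>\<in>Par N n. (\<Sum>\<nu>\<in>T. a \<nu> * b \<nu> \<tau>) * msym_tilde N \<tau> x)"
      using less.prems by (simp add: sum_subtractf finite_Par mult_delta_left)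
    also have "\<dots> = a \<rho> * msym N \<rho> x" using * by linarith
    finally show ?thesis using a(2) by simp
  qed
  moreover have "\<tau> \<in> Par N n \<and> prec_eq N \<tau> \<rho>" if "c \<tau> \<noteq> 0" for \<tau>
  proof (cases "\<tau> = \<rho>")
    case True
    then show ?thesis using less.prems by (simp add: prec_eq_def)
  next
    case False
    with that have "(\<Sum>\<nu>\<in>T. a \<nu> * b \<nu> \<tau>) \<noteq> 0" by (auto simp: c_def)
    then obtain \<nu> where "\<nu> \<in> T" "a \<nu> * b \<nu> \<tau> \<noteq> 0" by (rule sum.not_neutral_contains_not_neutral)
    then have \<nu>: "\<nu> \<in> T" "b \<nu> \<tau> \<noteq> 0" by auto
    then show ?thesis using b(1)[OF \<nu>] a(3)[of \<nu>] prec_eq_trans by (auto simp: T_def)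
  qed
  ultimately show ?case by blast
qed

text \<open>Existence and uniqueness, together with the value 0 off the index set, pin down the
  definite description in \<open>B\<close>. The support statement is what later makes the
  restriction to \<open>prec_eq\<close> in \<open>h\<close> harmless.\<close>

lemma B_expansion:
  assumes N: "N \<ge> 2" and \<rho>: "\<rho> \<in> Par N n"
  shows "msym N \<rho> x = (\<Sum>\<nu>\<in>Par N n. B N \<nu> \<rho> * msym_tilde N \<nu> x)"
    and "B N \<mu> \<rho> \<noteq> 0 \<Longrightarrow> prec_eq N \<mu> \<rho>"
proof -
  obtain b where "(\<forall>\<nu>. b \<nu> \<noteq> 0 \<longrightarrow> \<nu> \<in> Par N n \<and> prec_eq N \<nu> \<rho>) \<and>
    (\<forall>x. msym N \<rho> x = (\<Sum>\<nu>\<in>Par N n. b \<nu> * msym_tilde N \<nu> x))"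
    using msym_expansion[OF assms] by (rule exE)
  then have b: "b \<nu> \<noteq> 0 \<Longrightarrow> \<nu> \<in> Par N n \<and> prec_eq N \<nu> \<rho>"
    "msym N \<rho> x = (\<Sum>\<nu>\<in>Par N n. b \<nu> * msym_tilde N \<nu> x)" for \<nu> x
    by auto
  have "(THE b. (\<forall>\<nu>. \<nu> \<notin> Par N (weight N \<rho>) \<longrightarrow> b \<nu> = 0) \<and>
      (\<forall>x. msym N \<rho> x = (\<Sum>\<nu>\<in>Par N (weight N \<rho>). b \<nu> * msym_tilde N \<nu> x))) = b"
    unfolding Par_weight[OF \<rho>]
  proof (rule the_equality)
    show "(\<forall>\<nu>. \<nu> \<notin> Par N n \<longrightarrow> b \<nu> = 0) \<and> (\<forall>x. msym N \<rho> x = (\<Sum>\<nu>\<in>Par N n. b \<nu> * msym_tilde N \<nu> x))"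
      using b by blast
    fix b' assume b': "(\<forall>\<nu>. \<nu> \<notin> Par N n \<longrightarrow> b' \<nu> = 0) \<and> (\<forall>x. msym N \<rho> x = (\<Sum>\<nu>\<in>Par N n. b' \<nu> * msym_tilde N \<nu> x))"
    show "b' = b"
    proof
      fix \<nu>
      show "b' \<nu> = b \<nu>"
        using b' b(1)[of \<nu>] msym_tilde_sum_unique[OF N, where c=b' and d=b and \<rho>=\<nu> and n=n] b(2) by (cases "\<nu> \<in> Par N n") auto
    qed
  qed
  then have "B N \<nu> \<rho> = b \<nu>" for \<nu> by (simp add: B_def)
  then show "msym N \<rho> x = (\<Sum>\<nu>\<in>Par N n. B N \<nu> \<rho> * msym_tilde N \<nu> x)"
    and "B N \<mu> \<rho> \<noteq> 0 \<Longrightarrow> prec_eq N \<mu> \<rho>"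
    using b by auto
qed

lemma symmetric_rep_msym_tilde_sum:
  assumes "N \<ge> 2" "symmetric_coeffs N a" "poly_rep N n a F"
  shows "\<exists>q. \<forall>x. F x = (\<Sum>\<nu>\<in>Par N n. q \<nu> * msym_tilde N \<nu> x)"
proof (intro exI allI)
  fix x
  have "F x = (\<Sum>\<rho>\<in>Par N n. \<Sum>\<nu>\<in>Par N n. a \<rho> * B N \<nu> \<rho> * msym_tilde N \<nu> x)"
    unfolding symmetric_rep_msym_sum[OF assms(2,3)]
    by (rule sum.cong) (auto simp: B_expansion(1)[OF assms(1)] sum_distrib_left mult.assoc)
  also have "\<dots> = (\<Sum>\<nu>\<in>Par N n. (\<Sum>\<rho>\<in>Par N n. a \<rho> * B N \<nu> \<rho>) * msym_tilde N \<nu> x)"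
    by (subst sum.swap) (simp add: sum_distrib_right)
  finally show "F x = (\<Sum>\<nu>\<in>Par N n. (\<Sum>\<rho>\<in>Par N n. a \<rho> * B N \<nu> \<rho>) * msym_tilde N \<nu> x)" .
qed

lemma msym_tilde_rep:
  assumes "N \<ge> 2" "\<rho> \<in> Par N n"
  shows "\<exists>a. symmetric_coeffs N a \<and> poly_rep N n a (msym_tilde N \<rho>)"
proof -
  obtain a where "(\<forall>x. msym_tilde N \<rho> x = (\<Sum>\<nu>\<in>Par N n. a \<nu> * msym N \<nu> x)) \<and> a \<rho> > 0 \<and>
    (\<forall>\<nu>\<in>Par N n. a \<nu> \<noteq> 0 \<longrightarrow> prec_eq N \<nu> \<rho>)"
    using msym_tilde_expansion[OF assms] by (rule exE)
  then have a: "\<forall>x. msym_tilde N \<rho> x = (\<Sum>\<nu>\<in>Par N n. a \<nu> * msym N \<nu> x)" by (rule conjunct1)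
  have "poly_rep N n (\<lambda>\<alpha>. a (rearrange N \<alpha>)) (msym_tilde N \<rho>)"
    using msym_sum_rep[of N n a] by (simp add: poly_rep_def a)
  then show ?thesis using symmetric_coeffs_comp_rearrange by blast
qed

section \<open>Multiples of e_1 in the modified basis\<close>

lemma e1_times_msym_tilde:
  assumes "N \<ge> 2" "\<nu> \<in> Par N n"
  shows "e1 N x * msym_tilde N \<nu> x = msym_tilde N (\<nu>(1 := \<nu> 1 + 1)) x"
  using Par_first_ge_second[OF assms] by (simp add: msym_tilde_def Suc_diff_le)

text \<open>Multiplication by e_1 is a shift of the basis, raising the first part by one. Its image
  consists of the partitions with \<nu>_1 > \<nu>_2, so coordinates at \<nu>_1 = \<nu>_2
  vanish.\<close>

lemma e1_times_symmetric:
  assumes N: "N \<ge> 2" and F: "\<And>x. F x = (\<Sum>\<nu>\<in>Par N n. q \<nu> * msym_tilde N \<nu> x)"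
  shows "e1 N x * F x = (\<Sum>\<nu>\<in>Par N (Suc n). (if \<nu> 1 = \<nu> 2 then 0 else q (\<nu>(1 := \<nu> 1 - 1))) * msym_tilde N \<nu> x)"
proof -
  have "(\<Sum>\<nu>\<in>Par N (Suc n). (if \<nu> 1 = \<nu> 2 then 0 else q (\<nu>(1 := \<nu> 1 - 1))) * msym_tilde N \<nu> x) =
    (\<Sum>\<nu> | \<nu> \<in> Par N (Suc n) \<and> \<nu> 1 \<noteq> \<nu> 2. q (\<nu>(1 := \<nu> 1 - 1)) * msym_tilde N \<nu> x)"
  proof -
    have "(\<Sum>\<nu>\<in>Par N (Suc n). (if \<nu> 1 = \<nu> 2 then 0 else q (\<nu>(1 := \<nu> 1 - 1))) * msym_tilde N \<nu> x) =
      (\<Sum>\<nu>\<in>Par N (Suc n). if \<nu> 1 \<noteq> \<nu> 2 then q (\<nu>(1 := \<nu> 1 - 1)) * msym_tilde N \<nu> x else 0)"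
      by (rule sum.cong) simp_all
    then show ?thesis by (simp only: sum.inter_filter[OF finite_Par])
  qed
  also have "\<dots> = (\<Sum>\<nu>\<in>Par N n. q \<nu> * msym_tilde N (\<nu>(1 := \<nu> 1 + 1)) x)"
  proof (rule sum.reindex_bij_witness[where i="\<lambda>\<nu>. \<nu>(1 := \<nu> 1 + 1)" and j="\<lambda>\<nu>. \<nu>(1 := \<nu> 1 - 1)"])
    fix \<nu> assume \<nu>: "\<nu> \<in> {\<nu> \<in> Par N (Suc n). \<nu> 1 \<noteq> \<nu> 2}"
    then have "\<nu> 2 < \<nu> 1" using Par_first_ge_second[OF N, of \<nu> "Suc n"] by auto
    then show "\<nu>(1 := \<nu> 1 - 1) \<in> Par N n" "(\<nu>(1 := \<nu> 1 - 1))(1 := (\<nu>(1 := \<nu> 1 - 1)) 1 + 1) = \<nu>"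
      using Par_reduce_first[OF N, of \<nu> "Suc n" "\<nu> 1 - 1"] \<nu> by auto
    then show "q (\<nu>(1 := \<nu> 1 - 1)) * msym_tilde N ((\<nu>(1 := \<nu> 1 - 1))(1 := (\<nu>(1 := \<nu> 1 - 1)) 1 + 1)) x =
         q (\<nu>(1 := \<nu> 1 - 1)) * msym_tilde N \<nu> x" by simp
  next
    fix \<nu> assume \<nu>: "\<nu> \<in> Par N n"
    then show "\<nu>(1 := \<nu> 1 + 1) \<in> {\<nu> \<in> Par N (Suc n). \<nu> 1 \<noteq> \<nu> 2}"
      using Par_raise_first[of N \<nu> n 1] Par_first_ge_second[OF N \<nu>] N by auto
  qed auto
  also have "\<dots> = (\<Sum>\<nu>\<in>Par N n. q \<nu> * (e1 N x * msym_tilde N \<nu> x))"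
    by (rule sum.cong) (auto simp: e1_times_msym_tilde[OF N])
  also have "\<dots> = e1 N x * F x" by (simp add: F sum_distrib_left mult.left_commute)
  finally show ?thesis by simp
qed

text \<open>If \<nu>_1 > \<nu>_2, one factor e_1 can be split off and survives multiplication by
  p_m. The second clause therefore says that p_m acts modulo multiples of e_1: output coordinates
  along \<open>Par_tilde\<close> depend only on input coordinates along
  \<open>Par_tilde\<close>.\<close>

lemma power_sum_times_msym_tilde:
  assumes N: "N \<ge> 2" and \<nu>: "\<nu> \<in> Par N n"
  shows "\<exists>M. (\<forall>x. power_sum N m x * msym_tilde N \<nu> x = (\<Sum>\<tau>\<in>Par N (n + m). M \<tau> * msym_tilde N \<tau> x)) \<and>
    (\<nu> 1 \<noteq> \<nu> 2 \<longrightarrow> (\<forall>\<tau>\<in>Par_tilde N (n + m). M \<tau> = 0))"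
proof (cases "\<nu> 1 = \<nu> 2")
  case True
  obtain a where "symmetric_coeffs N a \<and> poly_rep N n a (msym_tilde N \<nu>)"
    using msym_tilde_rep[OF assms] by (rule exE)
  then have a: "symmetric_coeffs N a" "poly_rep N n a (msym_tilde N \<nu>)" by auto
  show ?thesis
    using symmetric_rep_msym_tilde_sum[OF N power_sum_mult_symmetric[OF a(1)] power_sum_mult_rep[OF a(2), of m]] True
    by simp
next
  case False
  then have lt: "\<nu> 2 < \<nu> 1" using Par_first_ge_second[OF assms] by simp
  have "\<nu> 1 \<le> weight N \<nu>" unfolding weight_def using N by (intro member_le_sum) auto
  then obtain n' where n': "n = Suc n'" using Par_weight[OF \<nu>] lt by (cases n) auto
  let ?\<nu> = "\<nu>(1 := \<nu> 1 - 1)"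
  have \<nu>': "?\<nu> \<in> Par N n'" using Par_reduce_first[OF N \<nu>, of "\<nu> 1 - 1"] lt n' by auto
  obtain a where "symmetric_coeffs N a \<and> poly_rep N n' a (msym_tilde N ?\<nu>)"
    using msym_tilde_rep[OF N \<nu>'] by (rule exE)
  then have a: "symmetric_coeffs N a" "poly_rep N n' a (msym_tilde N ?\<nu>)" by auto
  obtain q where q: "\<forall>x. power_sum N m x * msym_tilde N ?\<nu> x = (\<Sum>\<tau>\<in>Par N (n' + m). q \<tau> * msym_tilde N \<tau> x)"
    using symmetric_rep_msym_tilde_sum[OF N power_sum_mult_symmetric[OF a(1)] power_sum_mult_rep[OF a(2), of m]]
    by (rule exE)
  have "?\<nu>(1 := ?\<nu> 1 + 1) = \<nu>" using lt by auto
  then have "msym_tilde N \<nu> x = e1 N x * msym_tilde N ?\<nu> x" for x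
    using e1_times_msym_tilde[OF N \<nu>', of x] by simp
  then have "power_sum N m x * msym_tilde N \<nu> x =
      (\<Sum>\<tau>\<in>Par N (n + m). (if \<tau> 1 = \<tau> 2 then 0 else q (\<tau>(1 := \<tau> 1 - 1))) * msym_tilde N \<tau> x)" for x
    using e1_times_symmetric[OF N, where F="\<lambda>x. power_sum N m x * msym_tilde N ?\<nu> x" and n="n' + m" and q=q and x=x] q n'
    by (simp add: mult.left_commute)
  then show ?thesis
    by (intro exI[of _ "\<lambda>\<nu>. if \<nu> 1 = \<nu> 2 then 0 else q (\<nu>(1 := \<nu> 1 - 1))"]) (simp add: Par_tilde_def)
qed

subsection \<open>Growth of the coefficients of the generating function\<close>

unbundle fps_syntax

text \<open>The series \<open>0F1(t; y s)\<close> in the formal variable \<open>s\<close>.\<close>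

definition bessel_fps :: "real \<Rightarrow> real \<Rightarrow> real fps" where
  "bessel_fps t y = Abs_fps (\<lambda>k. y ^ k / (fact k * pochhammer t k))"

definition bessel_log_deriv :: "real \<Rightarrow> real \<Rightarrow> real fps" where
  "bessel_log_deriv t y = fps_deriv (bessel_fps t y) * inverse (bessel_fps t y)"

lemma bessel_fps_nth_0: "bessel_fps t y $ 0 = 1"
  by (simp add: bessel_fps_def)

text \<open>The hypergeometric equation s W'' + t W' = y W amounts to the recursion (n + 1) (n + t)
  w_{n+1} = y w_n; positivity of t keeps the factor n + t from vanishing.\<close>

lemma bessel_fps_ode:
  assumes "t > 0"
  shows "fps_X * fps_deriv (fps_deriv (bessel_fps t y)) + fps_const t * fps_deriv (bessel_fps t y) =
    fps_const y * bessel_fps t y"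
proof (rule fps_ext)
  fix n
  have "bessel_fps t y $ Suc n = y * bessel_fps t y $ n / ((real n + 1) * (real n + t))"
    by (simp add: bessel_fps_def pochhammer_Suc ac_simps)
  moreover have "real n + t \<noteq> 0" "real n + 1 \<noteq> 0" using assms by auto
  ultimately have "(real n + 1) * (real n + t) * bessel_fps t y $ Suc n = y * bessel_fps t y $ n"
    by simp
  then have rec: "(real n + t) * ((real n + 1) * bessel_fps t y $ Suc n) = y * bessel_fps t y $ n"
    by (simp only: ac_simps)
  show "(fps_X * fps_deriv (fps_deriv (bessel_fps t y)) + fps_const t * fps_deriv (bessel_fps t y)) $ n =
    (fps_const y * bessel_fps t y) $ n"
    using rec by (cases n) (simp_all add: algebra_simps)
qed

lemma fps_deriv_bessel: "fps_deriv (bessel_fps t y) = bessel_fps t y * bessel_log_deriv t y"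
proof -
  have "bessel_fps t y * bessel_log_deriv t y =
      fps_deriv (bessel_fps t y) * (inverse (bessel_fps t y) * bessel_fps t y)"
    unfolding bessel_log_deriv_def by (simp only: ac_simps)
  then show ?thesis by (simp add: inverse_mult_eq_1 bessel_fps_nth_0)
qed

text \<open>Insert W' = W U and W'' = W (U' + U^2) into the equation for W and cancel W, which is
  nonzero since its constant term is 1.\<close>

lemma bessel_log_deriv_riccati:
  assumes "t > 0"
  shows "fps_X * (fps_deriv (bessel_log_deriv t y) + bessel_log_deriv t y * bessel_log_deriv t y) +
    fps_const t * bessel_log_deriv t y = fps_const y"
proof -
  let ?W = "bessel_fps t y" and ?U = "bessel_log_deriv t y"
  have "?W * (fps_X * (fps_deriv ?U + ?U * ?U) + fps_const t * ?U) = ?W * fps_const y"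
    using bessel_fps_ode[OF assms, of y] by (simp add: fps_deriv_bessel algebra_simps)
  moreover have "?W \<noteq> 0" using bessel_fps_nth_0[of t y] by force
  ultimately show ?thesis by (metis mult_left_cancel)
qed

lemma bessel_log_deriv_0:
  assumes "t > 0"
  shows "bessel_log_deriv t y $ 0 = y / t"
  using arg_cong[OF bessel_log_deriv_riccati[OF assms, of y], of "\<lambda>f. f $ 0"] assms by (simp add: field_simps)

lemma bessel_log_deriv_Suc:
  assumes "t > 0"
  shows "bessel_log_deriv t y $ Suc n =
    - (\<Sum>i=0..n. bessel_log_deriv t y $ i * bessel_log_deriv t y $ (n - i)) / (real (Suc n) + t)"
proof -
  let ?U = "bessel_log_deriv t y"
  have "real (Suc n) * ?U $ Suc n + (\<Sum>i=0..n. ?U $ i * ?U $ (n - i)) + t * ?U $ Suc n = 0"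
    using arg_cong[OF bessel_log_deriv_riccati[OF assms, of y], of "\<lambda>f. f $ Suc n"]
    by (simp add: fps_mult_nth[of ?U ?U])
  then have "(real (Suc n) + t) * ?U $ Suc n = - (\<Sum>i=0..n. ?U $ i * ?U $ (n - i))"
    unfolding distrib_right by linarith
  moreover have "real (Suc n) + t \<noteq> 0" using assms by simp
  ultimately show ?thesis by (metis nonzero_mult_div_cancel_left)
qed

text \<open>The Riccati recursion respects degree in y: in the convolution, (i + 1) + (m - i + 1) =
  m + 2. This is what turns the sum of logarithmic derivatives over the variables into power
  sums.\<close>

lemma bessel_log_deriv_homogeneous:
  assumes "t > 0"
  shows "bessel_log_deriv t y $ n = y ^ Suc n * bessel_log_deriv t 1 $ n"
proof (induction n rule: less_induct)
  case (less n)
  show ?case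
  proof (cases n)
    case 0
    then show ?thesis by (simp add: bessel_log_deriv_0[OF assms])
  next
    case (Suc m)
    have "(\<Sum>i=0..m. bessel_log_deriv t y $ i * bessel_log_deriv t y $ (m - i)) =
      (\<Sum>i=0..m. y ^ Suc n * (bessel_log_deriv t 1 $ i * bessel_log_deriv t 1 $ (m - i)))"
    proof (rule sum.cong)
      fix i assume i: "i \<in> {0..m}"
      then have "y ^ Suc n = y ^ Suc i * y ^ Suc (m - i)"
        using Suc by (simp flip: power_add power_Suc)
      moreover have "bessel_log_deriv t y $ i = y ^ Suc i * bessel_log_deriv t 1 $ i"
        "bessel_log_deriv t y $ (m - i) = y ^ Suc (m - i) * bessel_log_deriv t 1 $ (m - i)"
        using i Suc by (auto intro!: less.IH simp del: power_Suc)
      ultimately show "bessel_log_deriv t y $ i * bessel_log_deriv t y $ (m - i) =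
          y ^ Suc n * (bessel_log_deriv t 1 $ i * bessel_log_deriv t 1 $ (m - i))"
        by (simp only: ac_simps)
    qed simp
    then show ?thesis
      unfolding Suc bessel_log_deriv_Suc[OF assms] sum_distrib_left[symmetric] by simp
  qed
qed

lemma bigo_inverse_power_weaken:
  assumes "f \<in> O[at_top](\<lambda>t::real. 1 / t ^ d)" "d' \<le> d"
  shows "f \<in> O[at_top](\<lambda>t::real. 1 / t ^ d')"
proof (rule landau_o.big_trans[OF assms(1)], rule landau_o.bigI[of 1])
  show "\<forall>\<^sub>F t in at_top. norm (1 / t ^ d) \<le> 1 * norm (1 / t ^ d' :: real)"
    using eventually_ge_at_top[of 1]
  proof eventually_elim
    case (elim t)
    then have "t ^ d' \<le> t ^ d" using assms(2) by (intro power_increasing)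
    then show ?case using elim by (simp add: field_simps)
  qed
qed simp

lemma bigo_eventually_eq:
  assumes "\<forall>\<^sub>F x in F. f x = g x" "g \<in> O[F](u)"
  shows "f \<in> O[F](u)"
  using assms(2) unfolding landau_o.big.in_cong[OF assms(1)] .

lemma bigo_inverse_power_mult:
  assumes "f \<in> O[at_top](\<lambda>t::real. 1 / t ^ d)" "g \<in> O[at_top](\<lambda>t::real. 1 / t ^ e)"
  shows "(\<lambda>t. f t * g t) \<in> O[at_top](\<lambda>t::real. 1 / t ^ (d + e))"
  using landau_o.big.mult[OF assms] by (simp add: power_add)

text \<open>Each product in the convolution has exponent (2i + 1) + (2(m - i) + 1) = 2m + 2, and the
  division by m + 1 + t supplies one more, giving 2(m + 1) + 1.\<close>

lemma bessel_log_deriv_bigo: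
  "(\<lambda>t. bessel_log_deriv t 1 $ n) \<in> O[at_top](\<lambda>t::real. 1 / t ^ (2 * n + 1))"
proof (induction n rule: less_induct)
  case (less n)
  have pos: "\<forall>\<^sub>F t in at_top. (t::real) > 0" by (rule eventually_gt_at_top)
  show ?case
  proof (cases n)
    case 0
    have "\<forall>\<^sub>F t in at_top. bessel_log_deriv t 1 $ n = 1 / t ^ (2 * n + 1)"
      using pos by eventually_elim (simp add: 0 bessel_log_deriv_0)
    then show ?thesis by (rule bigo_eventually_eq) simp
  next
    case (Suc m)
    have "(\<lambda>t. \<Sum>i=0..m. bessel_log_deriv t 1 $ i * bessel_log_deriv t 1 $ (m - i))
        \<in> O[at_top](\<lambda>t::real. 1 / t ^ (2 * m + 2))"
    proof (rule big_sum_in_bigo)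
      fix i assume i: "i \<in> {0..m}"
      have "(\<lambda>t. bessel_log_deriv t 1 $ i * bessel_log_deriv t 1 $ (m - i))
          \<in> O[at_top](\<lambda>t::real. 1 / t ^ ((2 * i + 1) + (2 * (m - i) + 1)))"
        using i Suc by (intro bigo_inverse_power_mult less.IH) auto
      moreover have "(2 * i + 1) + (2 * (m - i) + 1) = 2 * m + 2" using i by simp
      ultimately show "(\<lambda>t. bessel_log_deriv t 1 $ i * bessel_log_deriv t 1 $ (m - i))
          \<in> O[at_top](\<lambda>t::real. 1 / t ^ (2 * m + 2))" by simp
    qed
    moreover have "(\<lambda>t. - 1 / (real (Suc m) + t)) \<in> O[at_top](\<lambda>t::real. 1 / t ^ 1)"
    proof (rule landau_o.bigI[of 1])
      show "\<forall>\<^sub>F t in at_top. norm (- 1 / (real (Suc m) + t)) \<le> 1 * norm (1 / t ^ 1 :: real)"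
        using pos by eventually_elim (auto simp: field_simps)
    qed simp
    ultimately have "(\<lambda>t. (\<Sum>i=0..m. bessel_log_deriv t 1 $ i * bessel_log_deriv t 1 $ (m - i)) *
        (- 1 / (real (Suc m) + t))) \<in> O[at_top](\<lambda>t::real. 1 / t ^ ((2 * m + 2) + 1))"
      by (rule bigo_inverse_power_mult)
    also have "(2 * m + 2) + 1 = 2 * n + 1" using Suc by simp
    finally have "(\<lambda>t. (\<Sum>i=0..m. bessel_log_deriv t 1 $ i * bessel_log_deriv t 1 $ (m - i)) *
        (- 1 / (real (Suc m) + t))) \<in> O[at_top](\<lambda>t::real. 1 / t ^ (2 * n + 1))" .
    moreover have "\<forall>\<^sub>F t in at_top. bessel_log_deriv t 1 $ n =
        (\<Sum>i=0..m. bessel_log_deriv t 1 $ i * bessel_log_deriv t 1 $ (m - i)) * (- 1 / (real (Suc m) + t))"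
      using pos by eventually_elim (simp add: Suc bessel_log_deriv_Suc)
    ultimately show ?thesis by (rule bigo_eventually_eq[rotated])
  qed
qed

section \<open>Homogeneous parts of the generating function\<close>

definition bessel_product_coeff :: "nat \<Rightarrow> real \<Rightarrow> nat \<Rightarrow> (nat \<Rightarrow> real) \<Rightarrow> real" where
  "bessel_product_coeff N t n y = (\<Prod>i=1..N. bessel_fps t (y i)) $ n"

lemma fps_deriv_bessel_prod:
  assumes "finite I"
  shows "fps_deriv (\<Prod>i\<in>I. bessel_fps t (y i)) =
    (\<Prod>i\<in>I. bessel_fps t (y i)) * (\<Sum>i\<in>I. bessel_log_deriv t (y i))"
  using assms by induction (simp_all add: fps_deriv_bessel algebra_simps)

text \<open>The shift between \<open>n - i\<close> and \<open>Suc (n - i)\<close> is the homogeneity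
  degree: the j-th coefficient of a logarithmic derivative has degree j + 1 in its variable.\<close>

lemma bessel_product_coeff_Suc:
  assumes "t > 0"
  shows "real (Suc n) * bessel_product_coeff N t (Suc n) y =
    (\<Sum>i=0..n. bessel_log_deriv t 1 $ (n - i) * (power_sum N (Suc (n - i)) y * bessel_product_coeff N t i y))"
proof -
  have s: "(\<Sum>i=1..N. bessel_log_deriv t (y i)) $ m = bessel_log_deriv t 1 $ m * power_sum N (Suc m) y" for m
    by (simp add: fps_sum_nth power_sum_def sum_distrib_left bessel_log_deriv_homogeneous[OF assms, of "y _"] mult.commute)
  have "real (Suc n) * bessel_product_coeff N t (Suc n) y = fps_deriv (\<Prod>i=1..N. bessel_fps t (y i)) $ n"
    by (simp add: bessel_product_coeff_def)
  also have "\<dots> = (\<Sum>i=0..n. bessel_product_coeff N t i y * (\<Sum>i=1..N. bessel_log_deriv t (y i)) $ (n - i))"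
    by (simp add: fps_deriv_bessel_prod fps_mult_nth bessel_product_coeff_def)
  finally show ?thesis unfolding s by (simp add: ac_simps)
qed

lemma fps_prod_nth_hom_indices:
  fixes F :: "nat \<Rightarrow> 'a::comm_ring_1 fps"
  shows "(\<Prod>i=1..N. F i) $ n = (\<Sum>\<alpha>\<in>hom_indices N n. \<Prod>i=1..N. F i $ \<alpha> i)"
proof (induction N arbitrary: n)
  case 0
  have "hom_indices 0 n = (if n = 0 then {\<lambda>_. 0} else {})"
    by (auto simp: hom_indices_def multiindices_def weight_def)
  then show ?case by simp
next
  case (Suc N)
  have "(\<Prod>i=1..Suc N. F i) $ n = (\<Sum>k=0..n. \<Sum>\<alpha>\<in>hom_indices N k. (\<Prod>i=1..N. F i $ \<alpha> i) * F (Suc N) $ (n - k))"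
    using Suc.IH by (simp add: fps_mult_nth sum_distrib_right)
  also have "\<dots> = (\<Sum>(k,\<alpha>)\<in>Sigma {0..n} (hom_indices N). (\<Prod>i=1..N. F i $ \<alpha> i) * F (Suc N) $ (n - k))"
    by (subst sum.Sigma) (auto simp: finite_hom_indices)
  also have "\<dots> = (\<Sum>\<alpha>\<in>hom_indices (Suc N) n. \<Prod>i=1..Suc N. F i $ \<alpha> i)"
  proof (rule sum.reindex_bij_witness[where i="\<lambda>\<alpha>. (n - \<alpha> (Suc N), \<alpha>(Suc N := 0))"
        and j="\<lambda>(k,\<alpha>). \<alpha>(Suc N := n - k)"])
    fix p assume p: "p \<in> Sigma {0..n} (hom_indices N)"
    obtain k \<alpha> where [simp]: "p = (k, \<alpha>)" by (cases p)
    have *: "(\<Sum>i=1..N. (\<alpha>(Suc N := v)) i) = (\<Sum>i=1..N. \<alpha> i)" for v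
      by (rule sum.cong) auto
    have **: "(\<Prod>i=1..N. F i $ (\<alpha>(Suc N := v)) i) = (\<Prod>i=1..N. F i $ \<alpha> i)" for v
      by (rule prod.cong) auto
    have z: "\<alpha> (Suc N) = 0" using p by (simp add: hom_indices_def multiindices_def)
    show "(\<lambda>\<alpha>. (n - \<alpha> (Suc N), \<alpha>(Suc N := 0))) ((\<lambda>(k,\<alpha>). \<alpha>(Suc N := n - k)) p) = p"
      using p z by (auto simp: fun_eq_iff)
    show "(\<lambda>(k,\<alpha>). \<alpha>(Suc N := n - k)) p \<in> hom_indices (Suc N) n"
      using p * by (auto simp: hom_indices_def multiindices_def weight_def simp del: fun_upd_apply) auto
    show "(\<Prod>i=1..Suc N. F i $ ((\<lambda>(k,\<alpha>). \<alpha>(Suc N := n - k)) p) i) =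
        (\<lambda>(k,\<alpha>). (\<Prod>i=1..N. F i $ \<alpha> i) * F (Suc N) $ (n - k)) p"
      using ** by simp
  next
    fix \<alpha> assume \<alpha>: "\<alpha> \<in> hom_indices (Suc N) n"
    have *: "(\<Sum>i=1..N. (\<alpha>(Suc N := 0)) i) = (\<Sum>i=1..N. \<alpha> i)"
      by (rule sum.cong) auto
    have w: "(\<Sum>i=1..N. \<alpha> i) + \<alpha> (Suc N) = n"
      using \<alpha> by (simp add: hom_indices_def weight_def)
    then have n: "n - (n - \<alpha> (Suc N)) = \<alpha> (Suc N)" by linarith
    then show "(\<lambda>(k,\<alpha>). \<alpha>(Suc N := n - k)) ((\<lambda>\<alpha>. (n - \<alpha> (Suc N), \<alpha>(Suc N := 0))) \<alpha>) = \<alpha>"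
      by (simp add: fun_eq_iff)
    have "weight N (\<alpha>(Suc N := 0)) = n - \<alpha> (Suc N)"
      unfolding weight_def * using w by linarith
    moreover have "\<alpha>(Suc N := 0) \<in> multiindices N"
      using \<alpha> by (auto simp: hom_indices_def multiindices_def)
    ultimately show "(n - \<alpha> (Suc N), \<alpha>(Suc N := 0)) \<in> Sigma {0..n} (hom_indices N)"
      by (simp add: hom_indices_def)
  qed
  finally show ?case .
qed

lemma multi_fact_rearrange:
  assumes "\<alpha> \<in> multiindices N"
  shows "multi_fact N (rearrange N \<alpha>) = multi_fact N \<alpha>"
proof -
  obtain \<pi> where \<pi>: "\<pi> permutes {1..N}" "rearrange N \<alpha> = \<alpha> \<circ> \<pi>"
    by (rule ex_rearrange_permutes[OF assms])
  show ?thesis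
    unfolding multi_fact_def \<pi>(2) using prod.permute[OF \<pi>(1), of "\<lambda>i. fact (\<alpha> i) :: real"] by (simp add: comp_def)
qed

lemma multi_poch_rearrange:
  assumes "\<alpha> \<in> multiindices N"
  shows "multi_poch N t (rearrange N \<alpha>) = multi_poch N t \<alpha>"
proof -
  obtain \<pi> where \<pi>: "\<pi> permutes {1..N}" "rearrange N \<alpha> = \<alpha> \<circ> \<pi>"
    by (rule ex_rearrange_permutes[OF assms])
  show ?thesis
    unfolding multi_poch_def \<pi>(2) using prod.permute[OF \<pi>(1), of "\<lambda>i. pochhammer t (\<alpha> i)"] by (simp add: comp_def)
qed

text \<open>The coefficient 1 / (\<alpha>! (t)_\<alpha>) of x^\<alpha> is unchanged by permuting
  \<alpha>, so it can be evaluated at the sorted exponent and the monomials grouped.\<close>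

lemma bessel_product_coeff_msym:
  "bessel_product_coeff N t n y = (\<Sum>\<rho>\<in>Par N n. 1 / (multi_fact N \<rho> * multi_poch N t \<rho>) * msym N \<rho> y)"
proof -
  have "bessel_product_coeff N t n y =
      (\<Sum>\<alpha>\<in>hom_indices N n. 1 / (multi_fact N \<alpha> * multi_poch N t \<alpha>) * monomial N \<alpha> y)"
    unfolding bessel_product_coeff_def fps_prod_nth_hom_indices
    by (simp add: bessel_fps_def prod_dividef prod.distrib multi_fact_def multi_poch_def monomial_def)
  also have "\<dots> = (\<Sum>\<alpha>\<in>hom_indices N n.
      1 / (multi_fact N (rearrange N \<alpha>) * multi_poch N t (rearrange N \<alpha>)) * monomial N \<alpha> y)"
    by (rule sum.cong) (auto simp: multi_fact_rearrange multi_poch_rearrange hom_indicesD(1))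
  also have "\<dots> = (\<Sum>\<rho>\<in>Par N n. 1 / (multi_fact N \<rho> * multi_poch N t \<rho>) * msym N \<rho> y)"
    using msym_sum_rep[of N n "\<lambda>\<rho>. 1 / (multi_fact N \<rho> * multi_poch N t \<rho>)"] by (simp add: poly_rep_def)
  finally show ?thesis .
qed

text \<open>At t = \<kappa> + 1/2 this is 2^n h_\<nu>(1^N). The sum runs over all partitions, so
  that expanding every m_\<rho> and interchanging sums gives it directly as a coordinate.\<close>

definition h_coeff :: "nat \<Rightarrow> nat \<Rightarrow> real \<Rightarrow> (nat \<Rightarrow> nat) \<Rightarrow> real" where
  "h_coeff N n t \<nu> = (\<Sum>\<rho>\<in>Par N n. B N \<nu> \<rho> / (multi_fact N \<rho> * multi_poch N t \<rho>))"

lemma bessel_product_coeff_msym_tilde: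
  assumes "N \<ge> 2"
  shows "bessel_product_coeff N t n y = (\<Sum>\<nu>\<in>Par N n. h_coeff N n t \<nu> * msym_tilde N \<nu> y)"
proof -
  have "bessel_product_coeff N t n y = (\<Sum>\<rho>\<in>Par N n. \<Sum>\<nu>\<in>Par N n.
      B N \<nu> \<rho> / (multi_fact N \<rho> * multi_poch N t \<rho>) * msym_tilde N \<nu> y)"
    unfolding bessel_product_coeff_msym
    by (rule sum.cong) (auto simp: B_expansion(1)[OF assms] sum_divide_distrib)
  also have "\<dots> = (\<Sum>\<nu>\<in>Par N n. h_coeff N n t \<nu> * msym_tilde N \<nu> y)"
    unfolding h_coeff_def sum_distrib_right by (rule sum.swap)
  finally show ?thesis .
qed

text \<open>Only coordinates along \<open>Par_tilde\<close> are bounded; the others belong to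
  multiples of e_1 and may grow at will. The expansion is required for t > 0 only, which is where
  the Riccati recursion is available.\<close>

definition tilde_decay :: "nat \<Rightarrow> nat \<Rightarrow> nat \<Rightarrow> (real \<Rightarrow> (nat \<Rightarrow> real) \<Rightarrow> real) \<Rightarrow> bool" where
  "tilde_decay N n d F \<longleftrightarrow> (\<exists>q. (\<forall>t>0. \<forall>y. F t y = (\<Sum>\<nu>\<in>Par N n. q t \<nu> * msym_tilde N \<nu> y)) \<and>
    (\<forall>\<nu>\<in>Par_tilde N n. (\<lambda>t. q t \<nu>) \<in> O[at_top](\<lambda>t. 1 / t ^ d)))"

lemma tilde_decay_cong:
  assumes "tilde_decay N n d F" "\<And>t y. t > 0 \<Longrightarrow> G t y = F t y"
  shows "tilde_decay N n d G"
proof -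
  obtain q where "(\<forall>t>0. \<forall>y. F t y = (\<Sum>\<nu>\<in>Par N n. q t \<nu> * msym_tilde N \<nu> y)) \<and>
    (\<forall>\<nu>\<in>Par_tilde N n. (\<lambda>t. q t \<nu>) \<in> O[at_top](\<lambda>t. 1 / t ^ d))"
    using assms(1) unfolding tilde_decay_def by (rule exE)
  then show ?thesis
    unfolding tilde_decay_def using assms(2) by (intro exI[of _ q]) simp
qed

lemma tilde_decay_weaken:
  assumes "tilde_decay N n d F" "d' \<le> d"
  shows "tilde_decay N n d' F"
proof -
  obtain q where "(\<forall>t>0. \<forall>y. F t y = (\<Sum>\<nu>\<in>Par N n. q t \<nu> * msym_tilde N \<nu> y)) \<and>
    (\<forall>\<nu>\<in>Par_tilde N n. (\<lambda>t. q t \<nu>) \<in> O[at_top](\<lambda>t. 1 / t ^ d))"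
    using assms(1) unfolding tilde_decay_def by (rule exE)
  then show ?thesis
    unfolding tilde_decay_def using bigo_inverse_power_weaken[OF _ assms(2)] by (intro exI[of _ q]) simp
qed

lemma tilde_decay_sum:
  assumes "\<And>i. i \<in> I \<Longrightarrow> tilde_decay N n d (F i)"
  shows "tilde_decay N n d (\<lambda>t y. \<Sum>i\<in>I. F i t y)"
proof -
  let ?P = "\<lambda>i q. (\<forall>t>0. \<forall>y. F i t y = (\<Sum>\<nu>\<in>Par N n. q t \<nu> * msym_tilde N \<nu> y)) \<and>
    (\<forall>\<nu>\<in>Par_tilde N n. (\<lambda>t. q t \<nu>) \<in> O[at_top](\<lambda>t. 1 / t ^ d))"
  have "\<forall>i\<in>I. \<exists>q. ?P i q" using assms unfolding tilde_decay_def by (rule ballI)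
  then have "\<exists>q. \<forall>i\<in>I. ?P i (q i)" by (rule bchoice)
  then obtain q where q: "\<forall>i\<in>I. ?P i (q i)" by (rule exE)
  have "(\<Sum>i\<in>I. F i t y) = (\<Sum>\<nu>\<in>Par N n. (\<Sum>i\<in>I. q i t \<nu>) * msym_tilde N \<nu> y)" if "t > 0" for t y
    unfolding sum_distrib_right by (subst sum.swap) (use q that in \<open>auto intro!: sum.cong\<close>)
  moreover have "(\<lambda>t. \<Sum>i\<in>I. q i t \<nu>) \<in> O[at_top](\<lambda>t. 1 / t ^ d)" if "\<nu> \<in> Par_tilde N n" for \<nu>
    using q that by (intro big_sum_in_bigo) blast
  ultimately show ?thesis
    unfolding tilde_decay_def by (intro exI[of _ "\<lambda>t \<nu>. \<Sum>i\<in>I. q i t \<nu>"]) simp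
qed

text \<open>The uncontrolled coordinates never enter: their contribution to a coordinate along
  \<open>Par_tilde\<close> has coefficient 0. For the remaining ones the exponents add.\<close>

lemma tilde_decay_power_sum:
  assumes N: "N \<ge> 2" and F: "tilde_decay N n d F" and g: "g \<in> O[at_top](\<lambda>t. 1 / t ^ e)"
  shows "tilde_decay N (n + m) (e + d) (\<lambda>t y. g t * (power_sum N m y * F t y))"
proof -
  obtain q where "(\<forall>t>0. \<forall>y. F t y = (\<Sum>\<nu>\<in>Par N n. q t \<nu> * msym_tilde N \<nu> y)) \<and>
    (\<forall>\<nu>\<in>Par_tilde N n. (\<lambda>t. q t \<nu>) \<in> O[at_top](\<lambda>t. 1 / t ^ d))"
    using F unfolding tilde_decay_def by (rule exE)
  then have q: "t > 0 \<Longrightarrow> F t y = (\<Sum>\<nu>\<in>Par N n. q t \<nu> * msym_tilde N \<nu> y)"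
    "\<nu> \<in> Par_tilde N n \<Longrightarrow> (\<lambda>t. q t \<nu>) \<in> O[at_top](\<lambda>t. 1 / t ^ d)" for t y \<nu>
    by auto
  let ?P = "\<lambda>\<nu> M. (\<forall>x. power_sum N m x * msym_tilde N \<nu> x = (\<Sum>\<tau>\<in>Par N (n + m). M \<tau> * msym_tilde N \<tau> x)) \<and>
    (\<nu> 1 \<noteq> \<nu> 2 \<longrightarrow> (\<forall>\<tau>\<in>Par_tilde N (n + m). M \<tau> = 0))"
  have "\<forall>\<nu>\<in>Par N n. \<exists>M. ?P \<nu> M" by (intro ballI power_sum_times_msym_tilde[OF N])
  then have "\<exists>M. \<forall>\<nu>\<in>Par N n. ?P \<nu> (M \<nu>)" by (rule bchoice)
  then obtain M where "\<forall>\<nu>\<in>Par N n. ?P \<nu> (M \<nu>)" by (rule exE)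
  then have M: "power_sum N m x * msym_tilde N \<nu> x = (\<Sum>\<tau>\<in>Par N (n + m). M \<nu> \<tau> * msym_tilde N \<tau> x)"
    "\<nu> 1 \<noteq> \<nu> 2 \<Longrightarrow> \<tau> \<in> Par_tilde N (n + m) \<Longrightarrow> M \<nu> \<tau> = 0" if "\<nu> \<in> Par N n" for \<nu> \<tau> x
    using that by auto
  define r where "r = (\<lambda>t \<tau>. \<Sum>\<nu>\<in>Par N n. g t * (q t \<nu> * M \<nu> \<tau>))"
  have "g t * (power_sum N m y * F t y) = (\<Sum>\<tau>\<in>Par N (n + m). r t \<tau> * msym_tilde N \<tau> y)" if "t > 0" for t y
  proof -
    have "g t * (power_sum N m y * F t y) = (\<Sum>\<nu>\<in>Par N n. g t * q t \<nu> * (power_sum N m y * msym_tilde N \<nu> y))"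
      by (simp add: q(1)[OF that] sum_distrib_left ac_simps)
    also have "\<dots> = (\<Sum>\<nu>\<in>Par N n. \<Sum>\<tau>\<in>Par N (n + m). g t * (q t \<nu> * M \<nu> \<tau>) * msym_tilde N \<tau> y)"
      by (rule sum.cong) (auto simp: M(1) sum_distrib_left mult.assoc)
    also have "\<dots> = (\<Sum>\<tau>\<in>Par N (n + m). r t \<tau> * msym_tilde N \<tau> y)"
      unfolding r_def sum_distrib_right by (rule sum.swap)
    finally show ?thesis .
  qed
  moreover have "(\<lambda>t. r t \<tau>) \<in> O[at_top](\<lambda>t. 1 / t ^ (e + d))" if \<tau>: "\<tau> \<in> Par_tilde N (n + m)" for \<tau>
    unfolding r_def
  proof (rule big_sum_in_bigo)
    fix \<nu> assume \<nu>: "\<nu> \<in> Par N n"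
    show "(\<lambda>t. g t * (q t \<nu> * M \<nu> \<tau>)) \<in> O[at_top](\<lambda>t. 1 / t ^ (e + d))"
    proof (cases "\<nu> 1 = \<nu> 2")
      case True
      then have "(\<lambda>t. q t \<nu>) \<in> O[at_top](\<lambda>t. 1 / t ^ d)" using \<nu> by (intro q(2)) (simp add: Par_tilde_def)
      then have "(\<lambda>t. q t \<nu> * M \<nu> \<tau>) \<in> O[at_top](\<lambda>t. 1 / t ^ d)"
        by (cases "M \<nu> \<tau> = 0") simp_all
      then show ?thesis by (rule bigo_inverse_power_mult[OF g])
    next
      case False
      then show ?thesis using M(2)[OF \<nu> False \<tau>] by simp
    qed
  qed
  ultimately show ?thesis
    unfolding tilde_decay_def by (intro exI[of _ r]) simp
qed

text \<open>The factor \<open>g\<close> and the exponent \<open>d'\<close> are arbitrary because all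
  coordinates along \<open>Par_tilde\<close> are identically zero.\<close>

lemma tilde_decay_e1:
  assumes N: "N \<ge> 2" and F: "tilde_decay N n d F"
  shows "tilde_decay N (Suc n) d' (\<lambda>t y. g t * (e1 N y * F t y))"
proof -
  obtain q where "(\<forall>t>0. \<forall>y. F t y = (\<Sum>\<nu>\<in>Par N n. q t \<nu> * msym_tilde N \<nu> y)) \<and>
    (\<forall>\<nu>\<in>Par_tilde N n. (\<lambda>t. q t \<nu>) \<in> O[at_top](\<lambda>t. 1 / t ^ d))"
    using F unfolding tilde_decay_def by (rule exE)
  then have q: "F t y = (\<Sum>\<nu>\<in>Par N n. q t \<nu> * msym_tilde N \<nu> y)" if "t > 0" for t y
    using that by auto
  define r where "r = (\<lambda>t \<nu>. g t * (if \<nu> 1 = \<nu> 2 then 0 else q t (\<nu>(1 := \<nu> 1 - 1))))"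
  have "g t * (e1 N y * F t y) = (\<Sum>\<nu>\<in>Par N (Suc n). r t \<nu> * msym_tilde N \<nu> y)" if "t > 0" for t y
    using e1_times_symmetric[OF N q[OF that], of y] by (simp add: r_def sum_distrib_left mult.assoc)
  moreover have "(\<lambda>t. r t \<nu>) \<in> O[at_top](\<lambda>t. 1 / t ^ d')" if "\<nu> \<in> Par_tilde N (Suc n)" for \<nu>
    using that by (simp add: r_def Par_tilde_def)
  ultimately show ?thesis
    unfolding tilde_decay_def by (intro exI[of _ r]) simp
qed

text \<open>Strong induction along the recurrence: the summand \<open>i = m\<close> carries p_1 and
  drops out, every other one carries p_d with d = m - i + 1 \<ge> 2.\<close>

lemma tilde_decay_bessel_product:
  assumes N: "N \<ge> 2"
  shows "tilde_decay N n (n + (n + 1) div 2) (\<lambda>t. bessel_product_coeff N t n)"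
proof (induction n rule: less_induct)
  case (less n)
  show ?case
  proof (cases n)
    case 0
    \<comment> \<open>In degree 0 all Pochhammer symbols are empty, so the coordinates do not depend
      on t.\<close>
    have "multi_poch N t \<rho> = 1" if "\<rho> \<in> Par N 0" for t \<rho>
      using Par_weight[OF that] by (auto simp: weight_def multi_poch_def)
    then have "h_coeff N 0 t \<nu> = (\<Sum>\<rho>\<in>Par N 0. B N \<nu> \<rho> / multi_fact N \<rho>)" for t \<nu>
      by (simp add: h_coeff_def)
    then have "(\<lambda>t. h_coeff N 0 t \<nu>) \<in> O[at_top](\<lambda>t. 1)" for \<nu> by simp
    then show ?thesis
      unfolding tilde_decay_def using bessel_product_coeff_msym_tilde[OF N] 0
      by (intro exI[of _ "h_coeff N 0"]) simp
  next
    case (Suc m)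
    define T where "T = (\<lambda>i t y. bessel_log_deriv t 1 $ (m - i) / real (Suc m) *
        (power_sum N (Suc (m - i)) y * bessel_product_coeff N t i y))"
    have "tilde_decay N n (n + (n + 1) div 2) (T i)" if i: "i \<in> {0..m}" for i
    proof (cases "i = m")
      case True
      then show ?thesis
        using tilde_decay_e1[OF N less.IH[of m], of _ "\<lambda>t. bessel_log_deriv t 1 $ (m - i) / real (Suc m)"] Suc
        by (simp add: T_def power_sum_1[unfolded One_nat_def])
    next
      case False
      have "(\<lambda>t. bessel_log_deriv t 1 $ (m - i) / real (Suc m)) \<in> O[at_top](\<lambda>t. 1 / t ^ (2 * (m - i) + 1))"
        using landau_o.big.mult_in_1 bessel_log_deriv_bigo[of "m - i"] by simp
      from tilde_decay_power_sum[OF N less.IH[of i] this, of "Suc (m - i)"]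
      have "tilde_decay N (i + Suc (m - i)) ((2 * (m - i) + 1) + (i + (i + 1) div 2)) (T i)"
        using i Suc by (simp add: T_def)
      moreover have "i + Suc (m - i) = n" using i Suc by simp
      \<comment> \<open>With d = m - i + 1 this is 2d - 1 \<ge> d + ceiling(d/2), valid from d = 2
        on with equality there, combined with subadditivity of the ceiling.\<close>
      moreover have "n + (n + 1) div 2 \<le> (2 * (m - i) + 1) + (i + (i + 1) div 2)"
      proof -
        obtain j where "m = i + Suc j" using i False less_imp_Suc_add[of i m] by auto
        then show ?thesis using Suc by simp
      qed
      ultimately show ?thesis using tilde_decay_weaken by metis
    qed
    then have "tilde_decay N n (n + (n + 1) div 2) (\<lambda>t y. \<Sum>i\<in>{0..m}. T i t y)"
      by (rule tilde_decay_sum)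
    moreover have "bessel_product_coeff N t n y = (\<Sum>i\<in>{0..m}. T i t y)" if "t > 0" for t y
    proof -
      have "real (Suc m) * bessel_product_coeff N t n y = real (Suc m) * (\<Sum>i\<in>{0..m}. T i t y)"
        unfolding Suc bessel_product_coeff_Suc[OF that] T_def sum_distrib_left by (rule sum.cong) simp_all
      then show ?thesis by simp
    qed
    ultimately show ?thesis by (rule tilde_decay_cong)
  qed
qed

lemma h_coeff_bigo:
  assumes N: "N \<ge> 2" and \<nu>: "\<nu> \<in> Par_tilde N n"
  shows "(\<lambda>t. h_coeff N n t \<nu>) \<in> O[at_top](\<lambda>t. 1 / t ^ (n + (n + 1) div 2))"
proof -
  let ?P = "\<lambda>q. (\<forall>t>0. \<forall>y. bessel_product_coeff N t n y = (\<Sum>\<nu>\<in>Par N n. q t \<nu> * msym_tilde N \<nu> y)) \<and>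
    (\<forall>\<nu>\<in>Par_tilde N n. (\<lambda>t. q t \<nu>) \<in> O[at_top](\<lambda>t. 1 / t ^ (n + (n + 1) div 2)))"
  obtain q where q: "?P q"
    using tilde_decay_bessel_product[OF N, of n] unfolding tilde_decay_def by (rule exE)
  have "h_coeff N n t \<nu> = q t \<nu>" if "t > 0" for t
  proof (rule msym_tilde_sum_unique[OF N, where n=n and c="h_coeff N n t" and d="q t"])
    show "(\<Sum>\<rho>\<in>Par N n. h_coeff N n t \<rho> * msym_tilde N \<rho> x) = (\<Sum>\<rho>\<in>Par N n. q t \<rho> * msym_tilde N \<rho> x)" for x
      using q that bessel_product_coeff_msym_tilde[OF N, of t n x] by simp
    show "\<nu> \<in> Par N n" using \<nu> by (simp add: Par_tilde_def)
  qed
  then have "\<forall>\<^sub>F t in at_top. h_coeff N n t \<nu> = q t \<nu>"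
    by (rule eventually_mono[OF eventually_gt_at_top[of "0::real"]])
  moreover have "(\<lambda>t. q t \<nu>) \<in> O[at_top](\<lambda>t. 1 / t ^ (n + (n + 1) div 2))" using q \<nu> by simp
  ultimately show ?thesis by (rule bigo_eventually_eq)
qed

subsection \<open>Partial fractions\<close>

text \<open>Poles are added one at a time. The residues are kept explicit since they become the
  summands of the theorem, whereas of the polynomial part only existence matters.\<close>

lemma partial_fractions:
  fixes p :: "'a::field poly"
  assumes "finite J" "inj_on c J"
  shows "\<exists>q. \<forall>t. (\<forall>j\<in>J. t \<noteq> c j) \<longrightarrow> poly p t / (\<Prod>j\<in>J. t - c j) =
    poly q t + (\<Sum>j\<in>J. poly p (c j) / (\<Prod>i\<in>J - {j}. c j - c i) / (t - c j))"
  using assms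
proof (induction J rule: finite_induct)
  case empty
  show ?case by (intro exI[of _ p]) simp
next
  case (insert m J)
  define r where "r = (\<lambda>j. poly p (c j) / (\<Prod>i\<in>J - {j}. c j - c i))"
  have inj: "c m \<noteq> c j" if "j \<in> J" for j
    using insert.prems insert.hyps(2) that by auto
  obtain q where q: "\<forall>t. (\<forall>j\<in>J. t \<noteq> c j) \<longrightarrow> poly p t / (\<Prod>j\<in>J. t - c j) =
      poly q t + (\<Sum>j\<in>J. r j / (t - c j))"
    using insert.IH insert.prems unfolding r_def by auto
  define q' where "q' = synthetic_div q (c m)"
  have qq': "poly q t = (t - c m) * poly q' t + poly q (c m)" for t
    using arg_cong[OF synthetic_div_correct'[of "c m" q], of "\<lambda>p. poly p t"]
    by (simp add: q'_def algebra_simps)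
  define r' where "r' = (\<lambda>j. poly p (c j) / (\<Prod>i\<in>insert m J - {j}. c j - c i))"
  have r'j: "r' j = r j / (c j - c m)" if "j \<in> J" for j
  proof -
    have "insert m J - {j} = insert m (J - {j})" using that insert.hyps(2) by auto
    then show ?thesis using insert.hyps by (simp add: r_def r'_def mult.commute)
  qed
  \<comment> \<open>The residue at the new pole comes from evaluating the old identity at
    \<open>c m\<close>, which is not one of the old poles.\<close>
  have r'm: "r' m = poly q (c m) - (\<Sum>j\<in>J. r' j)"
  proof -
    have "insert m J - {m} = J" using insert.hyps(2) by auto
    then have "r' m = poly q (c m) + (\<Sum>j\<in>J. r j / (c m - c j))"
      using q inj by (simp add: r'_def)
    also have "(\<Sum>j\<in>J. r j / (c m - c j)) = (\<Sum>j\<in>J. - r' j)"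
      by (rule sum.cong) (simp_all add: r'j minus_divide_right)
    finally show ?thesis by (simp add: sum_negf)
  qed
  have "poly p t / (\<Prod>j\<in>insert m J. t - c j) = poly q' t + (\<Sum>j\<in>insert m J. r' j / (t - c j))"
    if t: "\<forall>j\<in>insert m J. t \<noteq> c j" for t
  proof -
    have tm: "t - c m \<noteq> 0" using t by simp
    have "poly p t / (\<Prod>j\<in>insert m J. t - c j) = (poly p t / (\<Prod>j\<in>J. t - c j)) / (t - c m)"
      using insert.hyps by (simp add: mult.commute)
    also have "\<dots> = (poly q t + (\<Sum>j\<in>J. r j / (t - c j))) / (t - c m)"
      using q t by simp
    also have "\<dots> = poly q' t + poly q (c m) / (t - c m) + (\<Sum>j\<in>J. r j / (t - c j) / (t - c m))"
      using tm by (subst qq') (simp add: add_divide_distrib sum_divide_distrib)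
    \<comment> \<open>The splitting 1 / ((t - a) (t - b)) = (1 / (t - a) - 1 / (t - b)) / (a -
      b).\<close>
    also have "(\<Sum>j\<in>J. r j / (t - c j) / (t - c m)) = (\<Sum>j\<in>J. r' j / (t - c j) - r' j / (t - c m))"
    proof (rule sum.cong)
      fix j assume j: "j \<in> J"
      have "t - c j \<noteq> 0" "c j - c m \<noteq> 0" using t j inj[OF j] by auto
      then show "r j / (t - c j) / (t - c m) = r' j / (t - c j) - r' j / (t - c m)"
        using tm by (simp add: r'j[OF j] divide_simps) (simp add: algebra_simps)
    qed simp
    also have "\<dots> = (\<Sum>j\<in>J. r' j / (t - c j)) - (\<Sum>j\<in>J. r' j) / (t - c m)"
      by (simp add: sum_subtractf sum_divide_distrib)
    finally show ?thesis
      using insert.hyps by (simp add: r'm diff_divide_distrib)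
  qed
  then show ?case unfolding r'_def by blast
qed

lemma prod_below: "d \<le> j \<Longrightarrow> (\<Prod>i\<in>{j - d..<j}. real i - real j) = (- 1) ^ d * fact d"
proof (induction d)
  case (Suc d)
  then have "{j - Suc d..<j} = insert (j - Suc d) {j - d..<j}" by auto
  with Suc show ?case by (simp add: of_nat_diff algebra_simps)
qed simp

lemma prod_above: "(\<Prod>i\<in>{Suc j..j + d}. real i - real j) = fact d"
  by (induction d) (simp_all add: prod.nat_ivl_Suc')

text \<open>Indices below j contribute (-1)^(j-k) (j-k)! and those above contribute (m-j)!; this is
  the origin of the sign and the two factorials in the theorem.\<close>

lemma prod_differences:
  assumes "k \<le> j" "j \<le> m"
  shows "(\<Prod>i\<in>{k..m} - {j}. real i - real j) = (- 1) ^ (j - k) * fact (j - k) * fact (m - j)"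
proof -
  have "{k..m} - {j} = {j - (j - k)..<j} \<union> {Suc j..j + (m - j)}" using assms by auto
  moreover have "{j - (j - k)..<j} \<inter> {Suc j..j + (m - j)} = {}" by auto
  ultimately show ?thesis
    by (simp only: prod.union_disjoint[OF finite_atLeastLessThan finite_atLeastAtMost] prod_above)
      (simp add: prod_below)
qed

lemma poly_pochhammer: "poly (pochhammer [:c, 1:] m) t = pochhammer (t + c) m"
  by (induction m) (simp_all add: pochhammer_Suc algebra_simps)

text \<open>A nonconstant polynomial is unbounded at infinity; a constant equals its limit.\<close>

lemma poly_tendsto_0:
  fixes p :: "real poly"
  assumes "(poly p \<longlongrightarrow> 0) at_top"
  shows "p = 0"
proof (cases "degree p = 0")
  case True
  then obtain a where p: "p = [:a:]" by (rule degree_eq_zeroE)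
  then have "poly p = (\<lambda>_. a)" by auto
  then have "((\<lambda>_. a) \<longlongrightarrow> 0) (at_top :: real filter)" using assms by simp
  then show ?thesis using p by (simp add: tendsto_const_iff)
next
  case False
  then have "filterlim (poly p) at_infinity at_infinity" by (intro filterlim_poly_at_infinity) simp
  then have "filterlim (poly p) at_infinity at_top"
    by (rule filterlim_mono[OF _ order_refl at_top_le_at_infinity])
  then show ?thesis using not_tendsto_and_filterlim_at_infinity[OF _ assms] by simp
qed

lemma pochhammer_bigo: "(\<lambda>t::real. pochhammer t m) \<in> O[at_top](\<lambda>t. t ^ m)"
proof (induction m)
  case (Suc m)
  have "(\<lambda>t::real. t + real m) \<in> O[at_top](\<lambda>t. t)"
  proof (rule landau_o.bigI[of 2])
    show "\<forall>\<^sub>F t in at_top. norm (t + real m) \<le> 2 * norm t"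
      using eventually_ge_at_top[of "real m"] by eventually_elim auto
  qed simp
  then show ?case using landau_o.big.mult[OF Suc] by (simp only: pochhammer_Suc power_Suc2)
qed simp

text \<open>For i \<ge> 2 the relation gives \<mu>_i \<le> \<lambda>_i, so (t)_{\<mu>_i} divides
  (t)_{\<lambda>_i} with quotient (t + \<mu>_i)_{\<lambda>_i - \<mu>_i}. Poles can thus come only
  from (t)_{k-1} / (t)_{\<mu>_1}, which is a polynomial if \<mu>_1 < k and otherwise has simple
  poles at 1 - j for k \<le> j \<le> \<mu>_1.\<close>

lemma pochhammer_ratio_partial_fractions:
  assumes lam: "lam \<in> Par N n" and \<mu>: "\<mu> \<in> Par N n" "prec_eq N lam \<mu>" and N: "N \<ge> 1" and k: "k \<ge> 1"
  shows "\<exists>q. \<forall>t>0. pochhammer t (k - 1) * (\<Prod>i=2..N. pochhammer t (lam i)) / multi_poch N t \<mu> =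
    poly q t + (if k \<le> \<mu> 1 then \<Sum>j=k..\<mu> 1.
          (\<Prod>i=2..N. pochhammer (1 - real j + real (\<mu> i)) (lam i - \<mu> i)) /
            (fact (j - k) * fact (\<mu> 1 - j)) * ((-1) ^ (j - k) / (t + real j - 1)) else 0)"
proof -
  define p where "p = (\<Prod>i=2..N. pochhammer [:real (\<mu> i), 1:] (lam i - \<mu> i))"
  have poly_p: "poly p t = (\<Prod>i=2..N. pochhammer (t + real (\<mu> i)) (lam i - \<mu> i))" for t
    by (simp add: p_def poly_prod poly_pochhammer)
  have mp: "multi_poch N t \<mu> = pochhammer t (\<mu> 1) * (\<Prod>i=2..N. pochhammer t (\<mu> i))" for t
    unfolding multi_poch_def using N by (simp add: prod.atLeast_Suc_atMost numeral_2_eq_2)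
  have "(\<Prod>i=2..N. pochhammer t (lam i)) = (\<Prod>i=2..N. pochhammer t (\<mu> i)) * poly p t" for t
    unfolding poly_p prod.distrib[symmetric]
    by (rule prod.cong) (use \<mu>(2) in \<open>auto simp: prec_eq_def intro!: pochhammer_product\<close>)
  then have ratio: "pochhammer t (k - 1) * (\<Prod>i=2..N. pochhammer t (lam i)) / multi_poch N t \<mu> =
      pochhammer t (k - 1) / pochhammer t (\<mu> 1) * poly p t" if "t > 0" for t
  proof -
    have "(\<Prod>i=2..N. pochhammer t (\<mu> i)) \<noteq> 0"
      using pochhammer_pos[OF that] by (simp add: less_imp_neq[symmetric])
    then show ?thesis using \<open>\<And>t. (\<Prod>i=2..N. pochhammer t (lam i)) = _ t\<close>[of t] by (simp add: mp)
  qed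
  show ?thesis
  proof (cases "k \<le> \<mu> 1")
    case False
    have "pochhammer t (k - 1) / pochhammer t (\<mu> 1) * poly p t =
        poly (pochhammer [:real (\<mu> 1), 1:] (k - 1 - \<mu> 1) * p) t" if "t > 0" for t
      using pochhammer_product[of "\<mu> 1" "k - 1" t] False pochhammer_pos[OF that, of "\<mu> 1"]
      by (simp add: poly_pochhammer)
    then show ?thesis using ratio False
      by (intro exI[of _ "pochhammer [:real (\<mu> 1), 1:] (k - 1 - \<mu> 1) * p"]) simp
  next
    case True
    \<comment> \<open>The j-th factor of a Pochhammer symbol is t + j - 1; the first k - 1 factors
      cancel, so the poles start at j = k.\<close>
    let ?c = "\<lambda>j::nat. 1 - real j"
    obtain q where q: "\<forall>t. (\<forall>j\<in>{k..\<mu> 1}. t \<noteq> ?c j) \<longrightarrow> poly p t / (\<Prod>j\<in>{k..\<mu> 1}. t - ?c j) =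
        poly q t + (\<Sum>j\<in>{k..\<mu> 1}. poly p (?c j) / (\<Prod>i\<in>{k..\<mu> 1} - {j}. ?c j - ?c i) / (t - ?c j))"
      using partial_fractions[of "{k..\<mu> 1}" ?c p] by (auto simp: inj_on_def)
    have "pochhammer t (k - 1) / pochhammer t (\<mu> 1) * poly p t = poly q t + (\<Sum>j=k..\<mu> 1.
          (\<Prod>i=2..N. pochhammer (1 - real j + real (\<mu> i)) (lam i - \<mu> i)) /
            (fact (j - k) * fact (\<mu> 1 - j)) * ((-1) ^ (j - k) / (t + real j - 1)))" if t: "t > 0" for t
    proof -
      have poch: "pochhammer t m = pochhammer t (k - 1) * (\<Prod>j=k..m. t - ?c j)" if "m \<ge> k - 1" for m
        using that
      proof (induction m rule: dec_induct)
        case base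
        have "{k..k - 1} = {}" using k by auto
        then show ?case by simp
      next
        case (step m)
        then show ?case using k by (simp add: pochhammer_Suc prod.nat_ivl_Suc' algebra_simps)
      qed
      have "pochhammer t (k - 1) \<noteq> 0" using pochhammer_pos[OF t, of "k - 1"] by simp
      moreover have "pochhammer t (\<mu> 1) = pochhammer t (k - 1) * (\<Prod>j=k..\<mu> 1. t - ?c j)"
        using True by (intro poch) simp
      ultimately have "pochhammer t (k - 1) / pochhammer t (\<mu> 1) * poly p t = poly p t / (\<Prod>j\<in>{k..\<mu> 1}. t - ?c j)"
        by simp
      also have "\<dots> = poly q t + (\<Sum>j\<in>{k..\<mu> 1}. poly p (?c j) / (\<Prod>i\<in>{k..\<mu> 1} - {j}. ?c j - ?c i) / (t - ?c j))"
        using q t k by auto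
      also have "(\<Sum>j\<in>{k..\<mu> 1}. poly p (?c j) / (\<Prod>i\<in>{k..\<mu> 1} - {j}. ?c j - ?c i) / (t - ?c j)) =
          (\<Sum>j=k..\<mu> 1. (\<Prod>i=2..N. pochhammer (1 - real j + real (\<mu> i)) (lam i - \<mu> i)) /
            (fact (j - k) * fact (\<mu> 1 - j)) * ((-1) ^ (j - k) / (t + real j - 1)))"
      proof (rule sum.cong)
        fix j assume j: "j \<in> {k..\<mu> 1}"
        have "(\<Prod>i\<in>{k..\<mu> 1} - {j}. ?c j - ?c i) = (\<Prod>i\<in>{k..\<mu> 1} - {j}. real i - real j)"
          by (rule prod.cong) auto
        also have "\<dots> = (- 1) ^ (j - k) * fact (j - k) * fact (\<mu> 1 - j)"
          using j by (intro prod_differences) auto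
        finally have d: "(\<Prod>i\<in>{k..\<mu> 1} - {j}. ?c j - ?c i) = (- 1) ^ (j - k) * fact (j - k) * fact (\<mu> 1 - j)" .
        have e: "X / ((- 1) ^ a * f * g) / s = X / (f * g) * ((- 1) ^ a / s)" for X f g s :: real and a
          by (cases "even a") auto
        have s: "t - ?c j = t + real j - 1" by simp
        show "poly p (?c j) / (\<Prod>i\<in>{k..\<mu> 1} - {j}. ?c j - ?c i) / (t - ?c j) =
            (\<Prod>i=2..N. pochhammer (1 - real j + real (\<mu> i)) (lam i - \<mu> i)) /
            (fact (j - k) * fact (\<mu> 1 - j)) * ((-1) ^ (j - k) / (t + real j - 1))"
          unfolding d e s poly_p ..
      qed simp
      finally show ?thesis .
    qed
    then show ?thesis using ratio True by (intro exI[of _ q]) simp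
  qed
qed

section \<open>Evaluation at the all-ones point and conclusion\<close>

lemma msym_ones_pos:
  assumes "\<rho> \<in> Par N n"
  shows "msym N \<rho> (\<lambda>_. 1) > 0"
proof -
  have "{\<alpha> \<in> multiindices N. rearrange N \<alpha> = \<rho>} \<subseteq> hom_indices N n"
    using weight_rearrange[of _ N] Par_weight[OF assms] by (auto simp: hom_indices_def)
  then have "finite {\<alpha> \<in> multiindices N. rearrange N \<alpha> = \<rho>}"
    using finite_hom_indices by (rule finite_subset)
  moreover have "\<rho> \<in> {\<alpha> \<in> multiindices N. rearrange N \<alpha> = \<rho>}"
    using assms rearrange_Par[OF assms] by (simp add: Par_def)
  ultimately show ?thesis
    unfolding msym_def by (intro sum_pos) (auto simp: monomial_def)
qed

lemma h_coeff_restrict: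
  assumes "N \<ge> 2"
  shows "h_coeff N n t \<nu> =
    (\<Sum>\<rho> | \<rho> \<in> Par N n \<and> prec_eq N \<nu> \<rho>. B N \<nu> \<rho> / (multi_fact N \<rho> * multi_poch N t \<rho>))"
  unfolding h_coeff_def
proof (rule sum.mono_neutral_right)
  show "\<forall>\<rho>\<in>Par N n - {\<rho> \<in> Par N n. prec_eq N \<nu> \<rho>}. B N \<nu> \<rho> / (multi_fact N \<rho> * multi_poch N t \<rho>) = 0"
    using B_expansion(2)[OF assms] by auto
qed (auto simp: finite_Par)

lemma h_ones:
  assumes "N \<ge> 2" "\<nu> \<in> Par N n"
  shows "h \<kappa> N \<nu> (\<lambda>_. 1) = 1 / 2 ^ n * h_coeff N n (\<kappa> + 1/2) \<nu>"
proof -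
  have "(\<Sum>\<rho> | \<rho> \<in> Par N n \<and> prec_eq N \<nu> \<rho>. B N \<nu> \<rho> / (multi_fact N \<rho> * multi_poch N (\<kappa> + 1/2) \<rho>) *
        (msym N \<rho> (\<lambda>i. 1\<^sup>2) / msym N \<rho> (\<lambda>_. 1))) = h_coeff N n (\<kappa> + 1/2) \<nu>"
    unfolding h_coeff_restrict[OF assms(1)]
  proof (rule sum.cong)
    fix \<rho> assume "\<rho> \<in> {\<rho> \<in> Par N n. prec_eq N \<nu> \<rho>}"
    \<comment> \<open>Positivity makes the quotient of the two values 1; a zero denominator would
      make it 0.\<close>
    then have "msym N \<rho> (\<lambda>_. 1) > 0" using msym_ones_pos by blast
    then show "B N \<nu> \<rho> / (multi_fact N \<rho> * multi_poch N (\<kappa> + 1/2) \<rho>) *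
        (msym N \<rho> (\<lambda>i. 1\<^sup>2) / msym N \<rho> (\<lambda>_. 1)) = B N \<nu> \<rho> / (multi_fact N \<rho> * multi_poch N (\<kappa> + 1/2) \<rho>)"
      by simp
  qed simp
  then show ?thesis unfolding h_def Par_weight[OF assms(2)] by simp
qed

theorem theorem4:
  fixes N n k :: nat and \<kappa> :: real and lam :: "nat \<Rightarrow> nat"
  assumes "N \<ge> 1" and "n \<ge> 1" and "\<kappa> \<ge> 0"
    and "lam \<in> Par_tilde N n"
    and "k = lam 1 + (n + 1) div 2"
  shows "h \<kappa> N lam (\<lambda>_. 1) =
    1 / 2 ^ n / (pochhammer (\<kappa> + 1/2) (k - 1) * (\<Prod>i=2..N. pochhammer (\<kappa> + 1/2) (lam i))) *
    (\<Sum>\<mu> | \<mu> \<in> Par N n \<and> prec_eq N lam \<mu> \<and> \<mu> 1 \<ge> k.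
       B N lam \<mu> / multi_fact N \<mu> *
       (\<Sum>j=k..\<mu> 1.
          (\<Prod>i=2..N. pochhammer (1 - real j + real (\<mu> i)) (lam i - \<mu> i)) /
            (fact (j - k) * fact (\<mu> 1 - j)) *
          ((-1) ^ (j - k) / (\<kappa> - 1/2 + real j))))"
proof -
  have lam: "lam \<in> Par N n" using assms(4) by (simp add: Par_tilde_def)
  have split: "weight N lam = lam 1 + (\<Sum>i=2..N. lam i)"
    unfolding weight_def using assms(1) by (simp add: sum.atLeast_Suc_atMost numeral_2_eq_2)
  \<comment> \<open>For N = 1 the second component is 0, so \<lambda>_1 = \<lambda>_2 would force n
    = 0.\<close>
  have N: "N \<ge> 2"
  proof (rule ccontr)
    assume "\<not> N \<ge> 2"
    then have "N = 1" using assms(1) by simp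
    then have "lam 2 = 0" using Par_outside[OF lam, of 2] by simp
    then have "weight N lam = 0" using split assms(4) \<open>N = 1\<close> by (simp add: Par_tilde_def)
    then show False using Par_weight[OF lam] assms(2) by simp
  qed
  have k: "k \<ge> 1" using assms(2,5) by simp
  let ?S = "{\<mu> \<in> Par N n. prec_eq N lam \<mu>}"
  define D where "D = (\<lambda>t::real. pochhammer t (k - 1) * (\<Prod>i=2..N. pochhammer t (lam i)))"
  define b where "b = (\<lambda>\<mu>. B N lam \<mu> / multi_fact N \<mu>)"
  define r where "r = (\<lambda>\<mu> t. \<Sum>j=k..\<mu> 1.
          (\<Prod>i=2..N. pochhammer (1 - real j + real (\<mu> i)) (lam i - \<mu> i)) /
            (fact (j - k) * fact (\<mu> 1 - j)) * ((-1) ^ (j - k) / (t + real j - 1)))"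
  define R where "R = (\<lambda>t. \<Sum>\<mu> | \<mu> \<in> Par N n \<and> prec_eq N lam \<mu> \<and> \<mu> 1 \<ge> k. b \<mu> * r \<mu> t)"
  have "\<forall>\<mu>\<in>?S. \<exists>q. \<forall>t>0. D t / multi_poch N t \<mu> = poly q t + (if k \<le> \<mu> 1 then r \<mu> t else 0)"
    unfolding D_def r_def using pochhammer_ratio_partial_fractions[OF lam _ _ assms(1) k] by simp
  then have "\<exists>q. \<forall>\<mu>\<in>?S. \<forall>t>0. D t / multi_poch N t \<mu> = poly (q \<mu>) t + (if k \<le> \<mu> 1 then r \<mu> t else 0)"
    by (rule bchoice)
  then obtain q where q: "\<forall>\<mu>\<in>?S. \<forall>t>0. D t / multi_poch N t \<mu> = poly (q \<mu>) t + (if k \<le> \<mu> 1 then r \<mu> t else 0)"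
    by (rule exE)
  define Q where "Q = (\<Sum>\<mu>\<in>?S. smult (b \<mu>) (q \<mu>))"
  have DH: "D t * h_coeff N n t lam = poly Q t + R t" if "t > 0" for t
  proof -
    have "D t * h_coeff N n t lam = (\<Sum>\<mu>\<in>?S. b \<mu> * (D t / multi_poch N t \<mu>))"
      unfolding h_coeff_restrict[OF N] sum_distrib_left by (rule sum.cong) (simp_all add: b_def)
    also have "\<dots> = (\<Sum>\<mu>\<in>?S. b \<mu> * poly (q \<mu>) t + (if k \<le> \<mu> 1 then b \<mu> * r \<mu> t else 0))"
      using q that by (intro sum.cong) (auto simp: distrib_left)
    also have "\<dots> = poly Q t + (\<Sum>\<mu>\<in>?S. if k \<le> \<mu> 1 then b \<mu> * r \<mu> t else 0)"
      by (simp add: Q_def poly_sum sum.distrib)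
    also have "(\<Sum>\<mu>\<in>?S. if k \<le> \<mu> 1 then b \<mu> * r \<mu> t else 0) = R t"
      unfolding R_def by (subst sum.inter_filter[symmetric]) (simp_all add: finite_Par conj_assoc)
    finally show ?thesis .
  qed
  have "((\<lambda>t. R t) \<longlongrightarrow> 0) at_top"
  proof -
    have "((\<lambda>t. a / (t + real j - 1)) \<longlongrightarrow> 0) at_top" for a :: real and j
      by real_asymp
    then have lim: "((\<lambda>t. c * (a / (t + real j - 1))) \<longlongrightarrow> 0) at_top" for c a :: real and j
      using tendsto_mult_right_zero by blast
    have "(r \<mu> \<longlongrightarrow> 0) at_top" for \<mu>
      unfolding r_def by (intro tendsto_null_sum lim)
    then show ?thesis unfolding R_def by (intro tendsto_null_sum tendsto_mult_right_zero)
  qed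
  moreover have "((\<lambda>t. D t * h_coeff N n t lam) \<longlongrightarrow> 0) at_top"
  proof -
    have "(\<lambda>t::real. \<Prod>i=2..N. pochhammer t (lam i)) \<in> O[at_top](\<lambda>t. \<Prod>i=2..N. t ^ lam i)"
      by (intro landau_o.big_prod pochhammer_bigo)
    then have "(\<lambda>t. D t * h_coeff N n t lam) \<in>
        O[at_top](\<lambda>t. t ^ (k - 1) * (\<Prod>i=2..N. t ^ lam i) * (1 / t ^ (n + (n + 1) div 2)))"
      unfolding D_def using h_coeff_bigo[OF N assms(4)] pochhammer_bigo by (intro landau_o.big.mult)
    also have "(\<lambda>t::real. t ^ (k - 1) * (\<Prod>i=2..N. t ^ lam i) * (1 / t ^ (n + (n + 1) div 2))) =
        (\<lambda>t. t ^ (k - 1 + (\<Sum>i=2..N. lam i)) / t ^ (n + (n + 1) div 2))"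
      by (simp add: power_sum power_add)
    \<comment> \<open>The decisive off-by-one: the decay exponent exceeds the degree of
      \<open>D\<close> by exactly one, so the product is O(1/t).\<close>
    also have "n + (n + 1) div 2 = Suc (k - 1 + (\<Sum>i=2..N. lam i))"
      using split Par_weight[OF lam] k assms(5) by simp
    finally have *: "(\<lambda>t. D t * h_coeff N n t lam) \<in>
        O[at_top](\<lambda>t. t ^ (k - 1 + (\<Sum>i=2..N. lam i)) / t ^ Suc (k - 1 + (\<Sum>i=2..N. lam i)))" .
    have ev: "\<forall>\<^sub>F t in at_top. t ^ m / t ^ Suc m = 1 / (t::real)" for m
      using eventually_gt_at_top[of 0] by eventually_elim simp
    from * have "(\<lambda>t. D t * h_coeff N n t lam) \<in> O[at_top](\<lambda>t. 1 / t)"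
      unfolding landau_o.big.cong[OF ev] .
    moreover have "(\<lambda>t::real. 1 / t) \<in> o[at_top](\<lambda>_. 1)" by real_asymp
    ultimately have "(\<lambda>t. D t * h_coeff N n t lam) \<in> o[at_top](\<lambda>_. 1)"
      by (rule landau_o.big_small_trans)
    then show ?thesis using smalloD_tendsto by fastforce
  qed
  ultimately have lim: "((\<lambda>t. D t * h_coeff N n t lam - R t) \<longlongrightarrow> 0) at_top"
    using tendsto_diff[of "\<lambda>t. D t * h_coeff N n t lam" 0 at_top R 0] by simp
  have "\<forall>\<^sub>F t in at_top. D t * h_coeff N n t lam - R t = poly Q t"
    using eventually_gt_at_top[of 0] by eventually_elim (simp add: DH)
  from tendsto_cong[THEN iffD1, OF this lim] have "((\<lambda>t. poly Q t) \<longlongrightarrow> 0) at_top" .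
  then have "Q = 0" by (rule poly_tendsto_0)
  \<comment> \<open>With \<open>Q = 0\<close> the identity \<open>DH\<close> holds for every t > 0
    without a polynomial part; only now is t specialised.\<close>
  let ?t = "\<kappa> + 1/2"
  have t: "?t > 0" using assms(3) by simp
  have "D ?t * h_coeff N n ?t lam = R ?t" using DH[OF t] \<open>Q = 0\<close> by simp
  moreover have "D ?t > 0" unfolding D_def using pochhammer_pos[OF t] by (intro mult_pos_pos prod_pos) auto
  ultimately have "h_coeff N n ?t lam = R ?t / D ?t" by (simp add: eq_divide_eq mult.commute)
  then have "h \<kappa> N lam (\<lambda>_. 1) = 1 / 2 ^ n / D ?t * R ?t"
    using h_ones[OF N lam, of \<kappa>] by simp
  moreover have "?t + real j - 1 = \<kappa> - 1/2 + real j" for j by simp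
  ultimately show ?thesis unfolding R_def r_def b_def D_def by (simp only:)
qed

end
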